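(* Let $\mu$ be a $\sigma$-finite measure on $\Omega$, and let $\mathscr{A}=(\mathscr{A}_t)_{t\in\Omega}$ and $\mathscr{B}=(\mathscr{B}_t)_{t\in\Omega}$ be weakly$^*$ measurable, $\mu$-a.e. bounded fields of operators in $\mathcal{B}(\mathcal{H})$. Then for every unitarily invariant norm $|||\cdot|||$ and all $X\in\mathcal{C}_{|||\cdot|||}(\mathcal{H})$, \[ \sup_{\delta}\left|\left|\left|\frac1{\mu(\delta)}\int_\delta\mathscr{A}_tX\mathscr{B}_t\,d\mu(t)-\frac1{\mu(\delta)}\int_\delta\mathscr{A}_t\,d\mu(t)\, X\, \frac1{\mu(\delta)}\int_\delta\mathscr{B}_t\, d\mu(t)\right|\right|\right| \le\min \left\{ r_\infty(\mathscr{A})r_\infty(\mathscr{B}),\ \frac{\mathrm{diam}_\infty(\mathscr{A})\,\mathrm{diam}_\infty(\mathscr{B})}2\right\}|||X|||, \] where the supremum is over all measurable $\delta\subseteq\Omega$ with $0<\mu(\delta)<\infty$.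
   Context: $\mathcal{H}$ is a separable complex Hilbert space. A field $t\mapsto\mathscr{A}_t\in\mathcal{B}(\mathcal{H})$ is weakly$^*$ measurable if $t\mapsto\langle\mathscr{A}_tf,f\rangle$ is measurable for all $f$; integrals are Gel'fand (weak) integrals: $\int_\delta\mathscr{A}_t\,d\mu(t)$ is the bounded operator $T$ with $\langle Tf,g\rangle=\int_\delta\langle\mathscr{A}_tf,g\rangle d\mu(t)$. For an a.e. bounded field, $r_\infty(\mathscr{A})=\min_{A\in\mathcal{B}(\mathcal{H})}\operatorname{ess\,sup}_{t\in\Omega}\|\mathscr{A}_t-A\|$ and $\mathrm{diam}_\infty(\mathscr{A})=\operatorname{ess\,sup}_{s,t\in\Omega}\|\mathscr{A}_s-\mathscr{A}_t\|$ (operator norms). A unitarily invariant norm is $|||X|||=\Phi(s_1(X),s_2(X),\dots)$ for a symmetric gauge function $\Phi$ ($s_n$ singular values); $\mathcal{C}_{|||\cdot|||}(\mathcal{H})$ is the ideal of compact operators on which it is finite. *)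

theory Defs
  imports "HOL-Analysis.Analysis" "HOL-Probability.Probability"
begin

class complex_inner = real_normed_vector +
  fixes scaleC :: "complex \<Rightarrow> 'a \<Rightarrow> 'a"
  fixes cinner :: "'a \<Rightarrow> 'a \<Rightarrow> complex"
  assumes scaleC_of_real: "scaleC (complex_of_real r) x = scaleR r x"
    and scaleC_add_right: "scaleC a (x + y) = scaleC a x + scaleC a y"
    and scaleC_add_left: "scaleC (a + b) x = scaleC a x + scaleC b x"
    and scaleC_scaleC: "scaleC a (scaleC b x) = scaleC (a * b) x"
    and scaleC_one: "scaleC 1 x = x"
    and cinner_add_left: "cinner (x + y) z = cinner x z + cinner y z"
    and cinner_scaleC_left: "cinner (scaleC a x) y = a * cinner x y"
    and cinner_commute: "cinner y x = cnj (cinner x y)"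
    and norm_eq_sqrt_cinner: "norm x = sqrt (Re (cinner x x))"

class chilbert_space = complex_inner + complete_space

definition bounded_clinear_op :: "('a::complex_inner \<Rightarrow> 'a) \<Rightarrow> bool" where
  "bounded_clinear_op T \<longleftrightarrow> bounded_linear T \<and> (\<forall>a x. T (scaleC a x) = scaleC a (T x))"

definition compact_op :: "('a::complex_inner \<Rightarrow> 'a) \<Rightarrow> bool" where
  "compact_op T \<longleftrightarrow> bounded_clinear_op T \<and> compact (closure (T ` ball 0 1))"

definition rank_le :: "('a::complex_inner \<Rightarrow> 'a) \<Rightarrow> nat \<Rightarrow> bool" where
  "rank_le F n \<longleftrightarrow> (\<exists>v::nat \<Rightarrow> 'a. \<forall>x. \<exists>c::nat \<Rightarrow> complex. F x = (\<Sum>i<n. scaleC (c i) (v i)))"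

text \<open>Singular values (approximation numbers); sv X n is s_(n+1)(X).\<close>
definition sv :: "('a::complex_inner \<Rightarrow> 'a) \<Rightarrow> nat \<Rightarrow> real" where
  "sv X n = Inf {onorm (\<lambda>x. X x - F x) | F. bounded_clinear_op F \<and> rank_le F n}"

definition fin_supp :: "(nat \<Rightarrow> real) \<Rightarrow> bool" where
  "fin_supp x \<longleftrightarrow> finite {i. x i \<noteq> 0}"

definition symmetric_gauge :: "((nat \<Rightarrow> real) \<Rightarrow> real) \<Rightarrow> bool" where
  "symmetric_gauge \<Phi> \<longleftrightarrow>
     (\<forall>x. fin_supp x \<longrightarrow> x \<noteq> (\<lambda>_. 0) \<longrightarrow> \<Phi> x > 0) \<and>
     (\<forall>x a. fin_supp x \<longrightarrow> \<Phi> (\<lambda>i. a * x i) = \<bar>a\<bar> * \<Phi> x) \<and>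
     (\<forall>x y. fin_supp x \<longrightarrow> fin_supp y \<longrightarrow> \<Phi> (\<lambda>i. x i + y i) \<le> \<Phi> x + \<Phi> y) \<and>
     \<Phi> (\<lambda>i. if i = 0 then 1 else 0) = 1 \<and>
     (\<forall>x \<pi>. fin_supp x \<longrightarrow> bij \<pi> \<longrightarrow> \<Phi> (x \<circ> \<pi>) = \<Phi> x) \<and>
     (\<forall>x. fin_supp x \<longrightarrow> \<Phi> (\<lambda>i. \<bar>x i\<bar>) = \<Phi> x)"

text \<open>The unitarily invariant norm associated with \<Phi>: \<Phi>(s_1(X), s_2(X), ...), with \<Phi>
  extended to infinite sequences by the supremum over finite truncations (as usual).\<close>
definition ui_norm :: "((nat \<Rightarrow> real) \<Rightarrow> real) \<Rightarrow> ('a::complex_inner \<Rightarrow> 'a) \<Rightarrow> ereal" where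
  "ui_norm \<Phi> X = (SUP n. ereal (\<Phi> (\<lambda>i. if i < n then sv X i else 0)))"

definition ui_ideal :: "((nat \<Rightarrow> real) \<Rightarrow> real) \<Rightarrow> ('a::complex_inner \<Rightarrow> 'a) set" where
  "ui_ideal \<Phi> = {X. compact_op X \<and> ui_norm \<Phi> X < \<infinity>}"

definition ess_sup :: "'t measure \<Rightarrow> ('t \<Rightarrow> ereal) \<Rightarrow> ereal" where
  "ess_sup M f = Inf {c. AE t in M. f t \<le> c}"

definition weak_star_measurable :: "'t measure \<Rightarrow> ('t \<Rightarrow> 'a::complex_inner \<Rightarrow> 'a) \<Rightarrow> bool" where
  "weak_star_measurable M A \<longleftrightarrow> (\<forall>f. (\<lambda>t. cinner (A t f) f) \<in> borel_measurable M)"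

definition ae_bounded_field :: "'t measure \<Rightarrow> ('t \<Rightarrow> 'a::complex_inner \<Rightarrow> 'a) \<Rightarrow> bool" where
  "ae_bounded_field M A \<longleftrightarrow> (\<forall>t\<in>space M. bounded_clinear_op (A t)) \<and>
                              (\<exists>C. AE t in M. onorm (A t) \<le> C)"

definition gelfand_integral ::
  "'t measure \<Rightarrow> 't set \<Rightarrow> ('t \<Rightarrow> 'a::complex_inner \<Rightarrow> 'a) \<Rightarrow> ('a \<Rightarrow> 'a)" where
  "gelfand_integral M \<delta> A = (THE T. bounded_clinear_op T \<and>
      (\<forall>f g. cinner (T f) g = (LINT t:\<delta>|M. cinner (A t f) g)))"

definition field_radius :: "'t measure \<Rightarrow> ('t \<Rightarrow> 'a::complex_inner \<Rightarrow> 'a) \<Rightarrow> ereal" where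
  "field_radius M A = (INF B\<in>{B. bounded_clinear_op B}.
      ess_sup M (\<lambda>t. ereal (onorm (\<lambda>x. A t x - B x))))"

definition field_diam :: "'t measure \<Rightarrow> ('t \<Rightarrow> 'a::complex_inner \<Rightarrow> 'a) \<Rightarrow> ereal" where
  "field_diam M A = ess_sup (M \<Otimes>\<^sub>M M) (\<lambda>(s, t). ereal (onorm (\<lambda>x. A s x - A t x)))"

definition avg_int :: "'t measure \<Rightarrow> 't set \<Rightarrow> ('t \<Rightarrow> 'a::complex_inner \<Rightarrow> 'a) \<Rightarrow> ('a \<Rightarrow> 'a)" where
  "avg_int M \<delta> A = (\<lambda>x. scaleR (1 / measure M \<delta>) (gelfand_integral M \<delta> A x))"

end

theory Submission
  imports Defs
begin

text \<open>Normalise \<open>\<mu>\<close> on \<open>\<delta>\<close> to a probability measure and write the difference of averages as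
  \<open>Z\<close>. In terms of a singular value decomposition \<open>X = \<Sum>\<^sub>k s\<^sub>k \<langle>\<cdot>, p\<^sub>k\<rangle> q\<^sub>k\<close>, the entry
  \<open>\<langle>Z e\<^sub>j, f\<^sub>j\<rangle>\<close> is the sum over \<open>k\<close> of \<open>s\<^sub>k\<close> times the covariance of
  \<open>\<langle>B\<^sub>t e\<^sub>j, p\<^sub>k\<rangle>\<close> and \<open>\<langle>A\<^sub>t q\<^sub>k, f\<^sub>j\<rangle>\<close>. Bounding covariances by variances, and sums of variances over \<open>j\<close> or over
  \<open>k\<close> by Bessel's inequality, gives a matrix with row and column sums at most \<open>\<alpha> \<beta>\<close>. Here
  \<open>\<alpha>\<close> can be the essential radius of the field \<open>A\<close>, since the variance is the least mean square
  distance to a constant, or its essential diameter divided by \<open>\<surd>2\<close>, since twice the variance is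
  the mean square distance of two independent samples; likewise \<open>\<beta>\<close> for \<open>B\<close>. Choosing \<open>e\<close> and
  \<open>f\<close> to exhaust the leading singular values of \<open>Z\<close> shows that these are weakly majorised by
  \<open>\<alpha> \<beta> s\<^sub>k\<close>, and Ky Fan dominance transfers this to every symmetric gauge norm.\<close>

text \<open>The difference of averages is not known to be compact, so no singular value
  decomposition of it is at hand; the vectors \<open>e\<close> and \<open>f\<close> reach its
  singular values only up to an error, which tends to 0 together with the truncation error of the
  decomposition of \<open>X\<close>. Row sums alone would bound only the total weight of the
  covariance matrix, leaving it free to sit on the largest singular value. The column sums cap the
  weight on each single one, and both together make the first n singular values of \<open>X\<close>
  the worst case. Each of the two fields is needed once along rows and once along columns. One of
  these is Bessel's inequality; the other would be Bessel's inequality for the adjoint, and is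
  proved directly. Radius and diameter are infima of essential bounds, so the estimates are made
  with slightly larger constants and the excess tends to 0 at the end.\<close>

section \<open>Complex inner product spaces\<close>

lemma cinner_add_right: "cinner x (y + z) = cinner x y + cinner (x::'a::complex_inner) z"
  by (subst (1 2 3) cinner_commute) (simp add: cinner_add_left)

lemma cinner_scaleC_right: "cinner x (scaleC a y) = cnj a * cinner (x::'a::complex_inner) y"
  by (subst (1 2) cinner_commute) (simp add: cinner_scaleC_left)

lemma cinner_scaleR_left: "cinner (r *\<^sub>R x) (y::'a::complex_inner) = of_real r * cinner x y"
  by (simp add: scaleC_of_real[symmetric] cinner_scaleC_left)

lemma cinner_scaleR_right: "cinner x (r *\<^sub>R (y::'a::complex_inner)) = of_real r * cinner x y"
  by (simp add: scaleC_of_real[symmetric] cinner_scaleC_right)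

lemma cinner_zero_left [simp]: "cinner 0 (y::'a::complex_inner) = 0"
  using cinner_scaleR_left[of 0 0 y] by simp

lemma cinner_zero_right [simp]: "cinner y (0::'a::complex_inner) = 0"
  using cinner_scaleR_right[of y 0 0] by simp

lemma cinner_minus_left: "cinner (- x) (y::'a::complex_inner) = - cinner x y"
  using cinner_scaleR_left[of "-1" x y] by simp

lemma cinner_minus_right: "cinner x (- (y::'a::complex_inner)) = - cinner x y"
  using cinner_scaleR_right[of x "-1" y] by simp

lemma cinner_diff_left: "cinner (x - y) (z::'a::complex_inner) = cinner x z - cinner y z"
  using cinner_add_left[of x "-y" z] by (simp add: cinner_minus_left)

lemma cinner_diff_right: "cinner z (x - (y::'a::complex_inner)) = cinner z x - cinner z y"
  using cinner_add_right[of z x "-y"] by (simp add: cinner_minus_right)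

lemma cinner_sum_left: "cinner (\<Sum>i\<in>I. f i) (y::'a::complex_inner) = (\<Sum>i\<in>I. cinner (f i) y)"
  by (induction I rule: infinite_finite_induct) (auto simp: cinner_add_left)

lemma cinner_sum_right: "cinner (y::'a::complex_inner) (\<Sum>i\<in>I. f i) = (\<Sum>i\<in>I. cinner y (f i))"
  by (induction I rule: infinite_finite_induct) (auto simp: cinner_add_right)

lemma scaleC_zero_left [simp]: "scaleC 0 (x::'a::complex_inner) = 0"
  using scaleC_of_real[of 0 x] by simp

lemma scaleC_zero_right [simp]: "scaleC a (0::'a::complex_inner) = 0"
  using scaleC_add_right[of a 0 "0::'a"] by simp

lemma scaleC_diff_right: "scaleC a (x - (y::'a::complex_inner)) = scaleC a x - scaleC a y"
  using scaleC_add_right[of a "x - y" y] by simp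

lemma scaleC_sum_right: "scaleC a (\<Sum>i\<in>I. f i::'a::complex_inner) = (\<Sum>i\<in>I. scaleC a (f i))"
  by (induction I rule: infinite_finite_induct) (auto simp: scaleC_add_right)

lemma scaleC_sum_left: "scaleC (\<Sum>i\<in>I. f i) (x::'a::complex_inner) = (\<Sum>i\<in>I. scaleC (f i) x)"
  by (induction I rule: infinite_finite_induct) (auto simp: scaleC_add_left)

lemma scaleC_scaleR: "scaleC a (r *\<^sub>R (x::'a::complex_inner)) = r *\<^sub>R scaleC a x"
  by (simp add: scaleC_of_real[symmetric] scaleC_scaleC mult.commute)

lemma cinner_self: "cinner x (x::'a::complex_inner) = of_real ((norm x)\<^sup>2)"
proof -
  have "sqrt (Re (cinner x x)) \<ge> 0" using norm_eq_sqrt_cinner[of x] norm_ge_zero[of x] by simp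
  then have "Re (cinner x x) \<ge> 0" by simp
  moreover have "Im (cinner x x) = 0" using cinner_commute[of x x]
    by (metis Reals_cnj_iff complex_is_Real_iff)
  ultimately show ?thesis by (simp add: complex_eq_iff norm_eq_sqrt_cinner)
qed

lemma norm_add_square:
  "(norm (x + (y::'a::complex_inner)))\<^sup>2 = (norm x)\<^sup>2 + (norm y)\<^sup>2 + 2 * Re (cinner x y)"
proof -
  have "of_real ((norm (x + y))\<^sup>2) = cinner x x + cinner y y + (cinner x y + cnj (cinner x y))"
    by (simp add: cinner_self[symmetric] cinner_add_left cinner_add_right cinner_commute[of y x]
         del: of_real_power)
  from arg_cong[OF this, of Re] show ?thesis by (simp add: cinner_self del: of_real_power)
qed

lemma norm_diff_square:
  "(norm (x - (y::'a::complex_inner)))\<^sup>2 = (norm x)\<^sup>2 + (norm y)\<^sup>2 - 2 * Re (cinner x y)"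
  using norm_add_square[of x "-y"] by (simp add: cinner_minus_right)

lemma norm_scaleC: "norm (scaleC a (x::'a::complex_inner)) = cmod a * norm x"
proof -
  have "complex_of_real ((norm (scaleC a x))\<^sup>2) = (a * cnj a) * of_real ((norm x)\<^sup>2)"
    by (simp add: cinner_self[symmetric] cinner_scaleC_left cinner_scaleC_right del: of_real_power)
  also have "\<dots> = of_real ((cmod a * norm x)\<^sup>2)"
    by (simp add: complex_norm_square[symmetric] power_mult_distrib)
  finally have "(norm (scaleC a x))\<^sup>2 = (cmod a * norm x)\<^sup>2"
    by (simp only: of_real_eq_iff)
  then show ?thesis by (simp add: power2_eq_iff_nonneg)
qed

text \<open>The first-order condition at an extremum, free of derivatives. It serves the minimiser
  in \<open>riesz_representation\<close> and the maximiser in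
  \<open>norm_attaining_cinner\<close>.\<close>

lemma linear_coeff_zero:
  fixes a b :: real
  assumes "\<And>t. 0 \<le> 2 * t * a + t\<^sup>2 * b"
  shows "a = 0"
proof (rule ccontr)
  assume "a \<noteq> 0"
  define c where "c = \<bar>b\<bar> + 1"
  have c: "c > 0" "b \<le> c" unfolding c_def by auto
  have "0 \<le> 2 * (- a / c) * a + (- a / c)\<^sup>2 * b" by (rule assms)
  also have "\<dots> \<le> 2 * (- a / c) * a + (- a / c)\<^sup>2 * c"
    using c by (intro add_left_mono mult_left_mono) auto
  also have "\<dots> = - a\<^sup>2 / c" using c by (simp add: field_simps power2_eq_square)
  finally have "a\<^sup>2 / c \<le> 0" by simp
  moreover have "a\<^sup>2 / c > 0" using \<open>a \<noteq> 0\<close> c by (intro divide_pos_pos) auto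
  ultimately show False by simp
qed

text \<open>Rotation by \<open>u\<close> turns a bound on real parts into one on moduli.\<close>

lemma unit_phase: "\<exists>u. cmod u \<le> 1 \<and> u * z = of_real (cmod z)"
proof (cases "z = 0")
  case False
  then have "cnj z / of_real (cmod z) * z = of_real (cmod z)"
    using complex_norm_square[of z] by (simp add: field_simps power2_eq_square)
  moreover have "cmod (cnj z / of_real (cmod z)) \<le> 1" using False by (simp add: norm_divide)
  ultimately show ?thesis by blast
qed (auto intro: exI[of _ 0])

lemma cauchy_schwarz: "cmod (cinner x y) \<le> norm x * norm (y::'a::complex_inner)"
proof -
  have re: "Re (cinner x y) \<le> norm x * norm y" for x y :: 'a
  proof (cases "x = 0 \<or> y = 0")
    case False
    have "0 \<le> (norm ((1/norm x) *\<^sub>R x - (1/norm y) *\<^sub>R y))\<^sup>2" by simp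
    also have "\<dots> = 2 - 2 * (Re (cinner x y) / (norm x * norm y))"
      using False by (subst norm_diff_square) (simp add: cinner_scaleR_left cinner_scaleR_right)
    finally have "Re (cinner x y) / (norm x * norm y) \<le> 1" by simp
    then show ?thesis using False by (simp add: field_simps)
  qed auto
  obtain u where u: "cmod u \<le> 1" "u * cinner x y = of_real (cmod (cinner x y))"
    using unit_phase by blast
  have "cmod (cinner x y) = Re (cinner (scaleC u x) y)" by (simp add: cinner_scaleC_left u)
  also have "\<dots> \<le> norm (scaleC u x) * norm y" by (rule re)
  also have "\<dots> \<le> norm x * norm y"
    using u(1) by (intro mult_right_mono) (auto simp: norm_scaleC mult_left_le_one_le)
  finally show ?thesis .
qed

lemma cinner_eq_imp_eq:
  assumes "\<And>g. cinner x g = cinner (y::'a::complex_inner) g" shows "x = y"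
proof -
  have "cinner (x - y) (x - y) = 0" using assms[of "x - y"] by (simp add: cinner_diff_left)
  then show ?thesis by (simp add: cinner_self)
qed

section \<open>Bounded operators\<close>

lemma
  assumes "bounded_clinear_op T"
  shows bounded_clinear_op_bl: "bounded_linear T"
    and bounded_clinear_op_add: "T (x + y) = T x + T y"
    and bounded_clinear_op_diff: "T (x - y) = T x - T y"
    and bounded_clinear_op_zero: "T 0 = 0"
    and bounded_clinear_op_scaleC: "T (scaleC a x) = scaleC a (T x)"
    and bounded_clinear_op_scaleR: "T (r *\<^sub>R x) = r *\<^sub>R T x"
    and bounded_clinear_op_sum: "T (\<Sum>i\<in>I. f i) = (\<Sum>i\<in>I. T (f i))"
    and bounded_clinear_op_norm: "norm (T x) \<le> onorm T * norm x"
  using assms unfolding bounded_clinear_op_def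
  by (auto simp: linear_simps onorm bounded_linear.linear linear_sum)

lemma bounded_clinear_opI:
  assumes "\<And>x y. T (x + y) = T x + T (y::'a::complex_inner)"
    and "\<And>a x. T (scaleC a x) = scaleC a (T x)"
    and "\<And>x. norm (T x) \<le> K * norm x"
  shows "bounded_clinear_op T"
  unfolding bounded_clinear_op_def
proof
  show "bounded_linear T"
    by (rule bounded_linear_intro[where K=K])
       (use assms in \<open>auto simp: scaleC_of_real[symmetric] mult.commute\<close>)
qed (use assms in auto)

lemma bounded_clinear_op_minus:
  assumes "bounded_clinear_op S" "bounded_clinear_op T"
  shows "bounded_clinear_op (\<lambda>x. S x - T x)"
  using assms unfolding bounded_clinear_op_def
  by (auto intro: bounded_linear_sub simp: scaleC_diff_right)

lemma bounded_clinear_op_compose: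
  assumes "bounded_clinear_op S" "bounded_clinear_op T"
  shows "bounded_clinear_op (\<lambda>x. S (T x))"
  using assms unfolding bounded_clinear_op_def
  by (auto intro: bounded_linear_compose)

lemma bounded_clinear_op_zero_fun: "bounded_clinear_op (\<lambda>x. 0)"
  by (simp add: bounded_clinear_op_def)

lemma bounded_clinear_op_scale:
  assumes "bounded_clinear_op S"
  shows "bounded_clinear_op (\<lambda>x. r *\<^sub>R S x)"
  using assms unfolding bounded_clinear_op_def
  by (auto intro: bounded_linear_const_scaleR simp: scaleC_scaleR)

text \<open>A variational argument takes the place of orthogonal complements: if
  \<open>\<psi>\<close> is the inner product with \<open>h\<close>, then \<open>J x\<close> is the
  square of \<open>norm (x - h)\<close> minus a constant, so \<open>h\<close> is sought as the
  minimiser of \<open>J\<close>.\<close>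

lemma riesz_representation:
  fixes \<psi> :: "'a::chilbert_space \<Rightarrow> complex"
  assumes add: "\<And>x y. \<psi> (x + y) = \<psi> x + \<psi> y"
    and sc: "\<And>a x. \<psi> (scaleC a x) = a * \<psi> x"
    and bd: "\<And>x. cmod (\<psi> x) \<le> C * norm x"
  shows "\<exists>h. \<forall>x. \<psi> x = cinner x h"
proof -
  define J where "J x = (norm x)\<^sup>2 - 2 * Re (\<psi> x)" for x
  have scR: "\<psi> (r *\<^sub>R x) = of_real r * \<psi> x" for r x by (simp add: scaleC_of_real[symmetric] sc)
  have bl: "bounded_linear \<psi>"
    by (rule bounded_linear_intro[where K=C])
       (auto simp: add scR scaleR_conv_of_real bd mult.commute[of _ C])
  have lower: "J x \<ge> - C\<^sup>2" for x
  proof -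
    have "2 * Re (\<psi> x) \<le> 2 * (C * norm x)"
      using bd[of x] complex_Re_le_cmod[of "\<psi> x"] by linarith
    moreover have "0 \<le> (norm x - C)\<^sup>2" by simp
    ultimately show ?thesis unfolding J_def power2_diff by (simp add: mult.commute mult.assoc)
  qed
  define m where "m = Inf (range J)"
  have bb: "bdd_below (range J)" using lower by (intro bdd_belowI[of _ "- C\<^sup>2"]) auto
  have mle: "m \<le> J x" for x unfolding m_def using bb by (simp add: cINF_lower)
  have "\<exists>x. J x < m + inverse (Suc n)" for n
    using cInf_less_iff[of "range J" "m + inverse (Suc n)"] bb unfolding m_def by auto
  then obtain x where x: "\<And>n. J (x n) < m + inverse (Suc n)" by metis
  \<comment> \<open>The part of \<open>J\<close> that involves \<open>\<psi>\<close> is real-linear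
    and cancels, so the parallelogram law makes minimising sequences Cauchy.\<close>
  have par: "(norm (u - v))\<^sup>2 = 2 * J u + 2 * J v - 4 * J ((1/2) *\<^sub>R (u + v))" for u v
    by (simp add: J_def norm_add_square norm_diff_square scR add power_mult_distrib
         power_divide cinner_scaleR_left cinner_scaleR_right algebra_simps)
  have cau: "(norm (x k - x l))\<^sup>2 \<le> 2 * inverse (Suc k) + 2 * inverse (Suc l)" for k l
    using par[of "x k" "x l"] x[of k] x[of l] mle[of "(1/2) *\<^sub>R (x k + x l)"] by linarith
  have "Cauchy x"
  proof (rule metric_CauchyI)
    fix e :: real assume e: "e > 0"
    obtain M where M: "inverse (real (Suc M)) < e\<^sup>2 / 4"
      using reals_Archimedean[of "e\<^sup>2/4"] e by auto
    show "\<exists>M. \<forall>m\<ge>M. \<forall>n\<ge>M. dist (x m) (x n) < e"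
    proof (intro exI allI impI)
      fix k l assume kl: "k \<ge> M" "l \<ge> M"
      have "inverse (real (Suc k)) \<le> inverse (real (Suc M))"
        "inverse (real (Suc l)) \<le> inverse (real (Suc M))"
        using kl by (auto intro!: le_imp_inverse_le)
      with cau[of k l] M have "(norm (x k - x l))\<^sup>2 < e\<^sup>2" by linarith
      then show "dist (x k) (x l) < e" using e by (simp add: dist_norm power2_less_imp_less)
    qed
  qed
  then obtain h where h: "x \<longlonglongrightarrow> h" using Cauchy_convergent_iff convergent_def by blast
  have "(\<lambda>n. J (x n)) \<longlonglongrightarrow> J h"
    unfolding J_def by (intro tendsto_intros h bounded_linear.tendsto[OF bl])
  moreover have "(\<lambda>n. m + inverse (real (Suc n))) \<longlonglongrightarrow> m + 0"
    by (intro tendsto_intros LIMSEQ_inverse_real_of_nat)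
  ultimately have "J h \<le> m" using x by (intro LIMSEQ_le[of "\<lambda>n. J (x n)"]) (auto intro: less_imp_le)
  have re: "Re (\<psi> g) = Re (cinner g h)" for g
  proof -
    have "0 \<le> 2 * t * (Re (cinner g h) - Re (\<psi> g)) + t\<^sup>2 * (norm g)\<^sup>2" for t
    proof -
      have "J h \<le> J (t *\<^sub>R g + h)" using mle \<open>J h \<le> m\<close> order_trans by blast
      then show ?thesis unfolding J_def
        by (simp add: norm_add_square add scR cinner_scaleR_left power_mult_distrib right_diff_distrib)
    qed
    from linear_coeff_zero[OF this] show ?thesis by simp
  qed
  have "Im (\<psi> g) = Im (cinner g h)" for g
    using re[of "scaleC (-\<i>) g"] unfolding sc cinner_scaleC_left by simp
  with re have "\<psi> g = cinner g h" for g by (simp only: complex_eq_iff simp_thms)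
  then show ?thesis by blast
qed

lemma bounded_sesquilinear_operator:
  fixes \<phi> :: "'a::chilbert_space \<Rightarrow> 'a \<Rightarrow> complex"
  assumes "\<And>x y g. \<phi> (x + y) g = \<phi> x g + \<phi> y g"
    and "\<And>a x g. \<phi> (scaleC a x) g = a * \<phi> x g"
    and "\<And>x g h. \<phi> x (g + h) = \<phi> x g + \<phi> x h"
    and "\<And>a x g. \<phi> x (scaleC a g) = cnj a * \<phi> x g"
    and bd: "\<And>x g. cmod (\<phi> x g) \<le> C * norm x * norm g"
  shows "\<exists>T. bounded_clinear_op T \<and> (\<forall>x g. cinner (T x) g = \<phi> x g)"
proof -
  \<comment> \<open>\<open>\<phi> x\<close> is conjugate-linear, so its conjugate is the functional
    to represent.\<close>
  have "\<exists>h. \<forall>g. cnj (\<phi> x g) = cinner g h" for x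
    by (rule riesz_representation[where C="C * norm x"]) (auto simp: assms)
  then obtain T where T: "\<And>x g. cnj (\<phi> x g) = cinner g (T x)" by metis
  have eq: "cinner (T x) g = \<phi> x g" for x g
    using T[of x g] cinner_commute[of g "T x"] by (metis complex_cnj_cnj)
  have "bounded_clinear_op T"
  proof (rule bounded_clinear_opI[where K=C])
    fix x
    have "norm (T x) * norm (T x) \<le> C * norm x * norm (T x)"
      using bd[of x "T x"] unfolding eq[symmetric] cinner_self norm_of_real by (simp add: power2_eq_square)
    moreover have "0 \<le> C * norm x"
    proof (cases "x = 0")
      case False
      have "0 \<le> C * norm x * norm x" using order_trans[OF norm_ge_zero bd] .
      then show ?thesis using False by (simp add: zero_le_mult_iff)
    qed simp
    ultimately show "norm (T x) \<le> C * norm x"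
      by (cases "T x = 0") auto
  next
    fix x y show "T (x + y) = T x + T y"
      by (rule cinner_eq_imp_eq) (simp only: eq assms cinner_add_left)
  next
    fix a x show "T (scaleC a x) = scaleC a (T x)"
      by (rule cinner_eq_imp_eq) (simp only: eq assms cinner_scaleC_left)
  qed
  with eq show ?thesis by blast
qed

section \<open>Orthonormal systems\<close>

text \<open>Zero vectors are allowed, so that the greedy constructions below need not stop early.\<close>

definition orthosys :: "(nat \<Rightarrow> 'a::complex_inner) \<Rightarrow> nat \<Rightarrow> bool" where
  "orthosys e n \<longleftrightarrow> (\<forall>i<n. norm (e i) = 0 \<or> norm (e i) = 1) \<and>
     (\<forall>i<n. \<forall>j<n. i \<noteq> j \<longrightarrow> cinner (e i) (e j) = 0)"

definition oproj :: "(nat \<Rightarrow> 'a::complex_inner) \<Rightarrow> nat \<Rightarrow> 'a \<Rightarrow> 'a" where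
  "oproj e n x = (\<Sum>j<n. scaleC (cinner x (e j)) (e j))"

lemma of_real_cmod_square: "(complex_of_real (cmod z))\<^sup>2 = z * cnj z"
  by (simp add: complex_norm_square[symmetric])

lemma orthosys_cinner_comb:
  assumes "orthosys e n" "i < n"
  shows "cinner (\<Sum>j<n. scaleC (c j) (e j)) (e i) = c i * cinner (e i) (e i)"
proof -
  have "cinner (\<Sum>j<n. scaleC (c j) (e j)) (e i) = (\<Sum>j<n. c j * cinner (e j) (e i))"
    by (simp add: cinner_sum_left cinner_scaleC_left)
  also have "\<dots> = (\<Sum>j<n. if j = i then c i * cinner (e i) (e i) else 0)"
    using assms by (intro sum.cong) (auto simp: orthosys_def)
  also have "\<dots> = c i * cinner (e i) (e i)" using assms(2) by simp
  finally show ?thesis .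
qed

lemma orthosys_norm_comb:
  assumes "orthosys e n"
  shows "(norm (\<Sum>j<n. scaleC (c j) (e j)))\<^sup>2 = (\<Sum>j<n. (cmod (c j))\<^sup>2 * (norm (e j))\<^sup>2)"
proof -
  let ?x = "\<Sum>j<n. scaleC (c j) (e j)"
  have "cinner ?x ?x = (\<Sum>i<n. cnj (c i) * cinner ?x (e i))"
    by (subst cinner_sum_right) (simp add: cinner_scaleC_right)
  also have "\<dots> = (\<Sum>i<n. (c i * cnj (c i)) * cinner (e i) (e i))"
    using assms by (intro sum.cong) (auto simp: orthosys_cinner_comb)
  also have "\<dots> = of_real (\<Sum>i<n. (cmod (c i))\<^sup>2 * (norm (e i))\<^sup>2)"
    by (simp add: of_real_cmod_square cinner_self)
  finally show ?thesis unfolding cinner_self of_real_eq_iff .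
qed

lemma orthosys_norm_comb_le:
  assumes "orthosys e n"
  shows "(norm (\<Sum>j<n. scaleC (c j) (e j)))\<^sup>2 \<le> (\<Sum>j<n. (cmod (c j))\<^sup>2)"
  unfolding orthosys_norm_comb[OF assms]
  using assms by (intro sum_mono) (auto simp: orthosys_def)

text \<open>Bessel's inequality and the contractivity of the complementary projection are both read
  off from this: one drops the left side, the other the sum.\<close>

lemma oproj_norm:
  assumes "orthosys e n"
  shows "(norm (x - oproj e n x))\<^sup>2 \<le> (norm x)\<^sup>2 - (\<Sum>j<n. (cmod (cinner x (e j)))\<^sup>2)"
proof -
  have "cinner x (oproj e n x) = of_real (\<Sum>j<n. (cmod (cinner x (e j)))\<^sup>2)"
    unfolding oproj_def
    by (simp add: cinner_sum_right cinner_scaleC_right of_real_cmod_square mult.commute)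
  moreover have "(norm (oproj e n x))\<^sup>2 \<le> (\<Sum>j<n. (cmod (cinner x (e j)))\<^sup>2)"
    unfolding oproj_def by (rule orthosys_norm_comb_le[OF assms])
  ultimately show ?thesis by (simp add: norm_diff_square del: of_real_sum)
qed

lemma bessel:
  assumes "orthosys e n"
  shows "(\<Sum>j<n. (cmod (cinner x (e j)))\<^sup>2) \<le> (norm x)\<^sup>2"
  using oproj_norm[OF assms, of x] zero_le_power2[of "norm (x - oproj e n x)"] by linarith

lemma oproj_norm_le:
  assumes "orthosys e n"
  shows "norm (x - oproj e n x) \<le> norm x"
proof -
  have "0 \<le> (\<Sum>j<n. (cmod (cinner x (e j)))\<^sup>2)" by (intro sum_nonneg) simp
  then have "(norm (x - oproj e n x))\<^sup>2 \<le> (norm x)\<^sup>2"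
    using oproj_norm[OF assms, of x] by linarith
  then show ?thesis by (rule power2_le_imp_le) simp
qed

lemma oproj_orthogonal:
  assumes "orthosys e n" "i < n"
  shows "cinner (x - oproj e n x) (e i) = 0"
proof -
  have "norm (e i) = 0 \<or> norm (e i) = 1" using assms by (auto simp: orthosys_def)
  then show ?thesis
    by (auto simp: cinner_diff_left oproj_def orthosys_cinner_comb[OF assms] cinner_self)
qed

lemma bounded_clinear_op_oproj:
  assumes "orthosys e n"
  shows "bounded_clinear_op (oproj e n)"
proof (rule bounded_clinear_opI[where K=1])
  fix x
  have "(norm (oproj e n x))\<^sup>2 \<le> (\<Sum>j<n. (cmod (cinner x (e j)))\<^sup>2)"
    unfolding oproj_def by (rule orthosys_norm_comb_le[OF assms])
  also have "\<dots> \<le> (norm x)\<^sup>2" by (rule bessel[OF assms])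
  finally show "norm (oproj e n x) \<le> 1 * norm x" by simp
qed (auto simp: oproj_def cinner_add_left cinner_scaleC_left scaleC_add_left sum.distrib
      scaleC_sum_right scaleC_scaleC)

text \<open>Bessel's inequality for the adjoint of \<open>T\<close> at \<open>p\<close>, without an
  adjoint: the coefficients of \<open>x\<close> are chosen to make \<open>cinner (T x) p\<close> the
  very sum \<open>S\<close>, and a factor \<open>sqrt S\<close> cancels.\<close>

lemma dual_bessel:
  assumes e: "orthosys e n" and T: "bounded_clinear_op T"
  shows "(\<Sum>j<n. (cmod (cinner (T (e j)) p))\<^sup>2) \<le> (onorm T)\<^sup>2 * (norm p)\<^sup>2"
proof -
  define c where "c j = cinner (T (e j)) p" for j
  define S where "S = (\<Sum>j<n. (cmod (c j))\<^sup>2)"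
  define x where "x = (\<Sum>j<n. scaleC (cnj (c j)) (e j))"
  have S0: "0 \<le> S" unfolding S_def by (intro sum_nonneg) auto
  have "(norm x)\<^sup>2 \<le> S"
    unfolding x_def S_def using orthosys_norm_comb_le[OF e, of "\<lambda>j. cnj (c j)"] by simp
  then have nx: "norm x \<le> sqrt S" by (rule real_le_rsqrt)
  have "cinner (T x) p = of_real S"
    unfolding x_def S_def
    by (simp add: bounded_clinear_op_sum[OF T] bounded_clinear_op_scaleC[OF T] cinner_sum_left
        cinner_scaleC_left c_def[symmetric] of_real_cmod_square mult.commute)
  then have "S \<le> norm (T x) * norm p" using cauchy_schwarz[of "T x" p] S0 by simp
  also have "\<dots> \<le> onorm T * sqrt S * norm p"
    using nx bounded_clinear_op_norm[OF T, of x] onorm_pos_le[OF bounded_clinear_op_bl[OF T]]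
    by (intro mult_right_mono) (auto intro: order_trans mult_left_mono)
  finally have le: "sqrt S * sqrt S \<le> (onorm T * norm p) * sqrt S" using S0 by (simp add: mult_ac)
  have "sqrt S \<le> onorm T * norm p"
  proof (cases "S = 0")
    case True then show ?thesis using onorm_pos_le[OF bounded_clinear_op_bl[OF T]] by simp
  next
    case False then show ?thesis using le S0 by (simp only: mult_le_cancel_right) auto
  qed
  then have "S \<le> (onorm T * norm p)\<^sup>2" using S0 by (metis real_sqrt_le_iff real_sqrt_pow2 power_mono real_sqrt_ge_zero)
  then show ?thesis unfolding S_def c_def by (simp add: power_mult_distrib)
qed

lemma orthosys_extend:
  assumes "orthosys e n" "norm u = 0 \<or> norm u = 1" "\<And>i. i < n \<Longrightarrow> cinner u (e i) = 0"
  shows "orthosys (e(n := u)) (Suc n)"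
proof -
  have "cinner (e i) u = 0" if "i < n" for i using assms(3)[OF that] by (subst cinner_commute) simp
  with assms show ?thesis unfolding orthosys_def by (auto simp: less_Suc_eq)
qed

lemma oproj_extend: "oproj (e(n := u)) (Suc n) x = oproj e n x + scaleC (cinner x u) u"
  by (auto simp: oproj_def intro!: sum.cong)

section \<open>Singular values\<close>

lemma sv_bdd_below:
  "bdd_below {onorm (\<lambda>x. X x - F x) | F. bounded_clinear_op F \<and> rank_le F n}"
  if "bounded_clinear_op X"
  using onorm_pos_le[OF bounded_clinear_op_bl[OF bounded_clinear_op_minus[OF that]]]
  by (intro bdd_belowI[of _ 0]) auto

lemma rank_le_zero: "rank_le (\<lambda>x. 0::'a::complex_inner) n"
  unfolding rank_le_def by (auto intro!: exI[of _ "\<lambda>_. 0"])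

lemma rank_le_Suc: assumes "rank_le F n" shows "rank_le F (Suc n)"
proof -
  obtain v where v: "\<And>x. \<exists>c. F x = (\<Sum>i<n. scaleC (c i) (v i))"
    using assms unfolding rank_le_def by blast
  have "\<exists>c. F x = (\<Sum>i<Suc n. scaleC (c i) (v i))" for x
  proof -
    obtain c where "F x = (\<Sum>i<n. scaleC (c i) (v i))" using v by blast
    then have "F x = (\<Sum>i<Suc n. scaleC ((c(n := 0)) i) (v i))" by simp
    then show ?thesis by blast
  qed
  then show ?thesis unfolding rank_le_def by blast
qed

lemma sv_le_onorm:
  assumes "bounded_clinear_op X" "bounded_clinear_op F" "rank_le F n"
  shows "sv X n \<le> onorm (\<lambda>x. X x - F x)"
  unfolding sv_def by (rule cInf_lower) (use assms sv_bdd_below in auto)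

lemma sv_nonempty: "{onorm (\<lambda>x. X x - F x) | F. bounded_clinear_op F \<and> rank_le F n} \<noteq> {}"
  using bounded_clinear_op_zero_fun rank_le_zero by blast

lemma sv_greatest:
  assumes "\<And>F. bounded_clinear_op F \<Longrightarrow> rank_le F n \<Longrightarrow> c \<le> onorm (\<lambda>x. X x - F x)"
  shows "c \<le> sv X n"
  unfolding sv_def by (rule cInf_greatest[OF sv_nonempty]) (use assms in auto)

lemma sv_nonneg:
  assumes "bounded_clinear_op X" shows "0 \<le> sv X n"
  using assms by (intro sv_greatest onorm_pos_le bounded_clinear_op_bl bounded_clinear_op_minus)

lemma sv_Suc_le:
  assumes "bounded_clinear_op X" shows "sv X (Suc n) \<le> sv X n"
  using assms by (intro sv_greatest sv_le_onorm rank_le_Suc)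

lemma sv_antimono:
  assumes "bounded_clinear_op X" "m \<le> n" shows "sv X n \<le> sv X m"
  using lift_Suc_antimono_le[of "sv X", OF sv_Suc_le[OF assms(1)] assms(2)] .

lemma rank_le_oproj: "rank_le (\<lambda>x. oproj e n (Z x)) n"
  unfolding rank_le_def oproj_def
  by (rule exI[of _ e], rule allI, rule_tac x="\<lambda>j. cinner (Z x) (e j)" in exI) (rule refl)

text \<open>Compressing \<open>Z\<close> to a greedily chosen pair of orthonormal systems almost recovers its
  singular values, with no compactness of \<open>Z\<close>: each \<open>f j\<close> is the normalised component of
  \<open>Z (e j)\<close> orthogonal to the earlier ones, so \<open>Z - P\<^sub>f Z\<close> kills the earlier \<open>e j\<close>.\<close>

lemma greedy_singular_systems:
  assumes Z: "bounded_clinear_op Z" and \<epsilon>: "\<epsilon> > 0"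
  shows "\<exists>e f. orthosys e n \<and> orthosys f n \<and> (\<forall>j<n. sv Z j - \<epsilon> \<le> Re (cinner (Z (e j)) (f j)))
           \<and> (\<forall>j<n. Z (e j) = oproj f n (Z (e j)))"
proof (induction n)
  case 0
  show ?case by (auto simp: orthosys_def)
next
  case (Suc k)
  then obtain e f where e: "orthosys e k" and f: "orthosys f k"
    and s: "\<And>j. j < k \<Longrightarrow> sv Z j - \<epsilon> \<le> Re (cinner (Z (e j)) (f j))"
    and p: "\<And>j. j < k \<Longrightarrow> Z (e j) = oproj f k (Z (e j))" by blast
  have "\<exists>u v. (norm u = 0 \<or> norm u = 1) \<and> (norm v = 0 \<or> norm v = 1) \<and>
      (\<forall>i<k. cinner u (e i) = 0) \<and> (\<forall>i<k. cinner v (f i) = 0) \<and>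
      sv Z k - \<epsilon> \<le> Re (cinner (Z u) v) \<and> Z u = oproj f k (Z u) + scaleC (cinner (Z u) v) v"
  \<comment> \<open>A small singular value asks nothing of the new entry, so zero vectors will do.
    Otherwise \<open>sv Z k - \<epsilon>\<close> is positive, which makes the vectors below
    nonzero.\<close>
  proof (cases "sv Z k \<le> \<epsilon>")
    case True
    then show ?thesis
      by (intro exI[of _ 0]) (auto simp: bounded_clinear_op_zero[OF Z] oproj_def)
  next
    case False
    define W where "W x = Z x - oproj f k (Z x)" for x
    have PZ: "bounded_clinear_op (\<lambda>x. oproj f k (Z x))"
      by (rule bounded_clinear_op_compose[OF bounded_clinear_op_oproj[OF f] Z])
    have W: "bounded_clinear_op W"
      unfolding W_def by (rule bounded_clinear_op_minus[OF Z PZ])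
    \<comment> \<open>\<open>W\<close> is \<open>Z\<close> minus an operator of rank at most
      \<open>k\<close>, so its norm is among those whose infimum is \<open>sv Z k\<close>.\<close>
    have "sv Z k \<le> onorm W"
      unfolding W_def by (rule sv_le_onorm[OF Z PZ rank_le_oproj])
    then have "\<not> onorm W \<le> sv Z k - \<epsilon>" using \<epsilon> by simp
    then obtain x where x: "(sv Z k - \<epsilon>) * norm x < norm (W x)"
      using onorm_bound[of "sv Z k - \<epsilon>" W] False by (meson diff_ge_0_iff_ge linorder_not_less nle_le)
    \<comment> \<open>Removing the components along the earlier \<open>e j\<close> leaves
      \<open>W x\<close> unchanged, since \<open>W\<close> kills them, and does not lengthen
      \<open>x\<close>, so the lower bound on the quotient survives.\<close>
    define x' where "x' = x - oproj e k x"
    have We: "W (e j) = 0" if "j < k" for j using p[OF that] by (simp add: W_def)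
    have "W (oproj e k x) = 0"
      unfolding oproj_def
      by (simp add: bounded_clinear_op_sum[OF W] bounded_clinear_op_scaleC[OF W] We)
    then have Wx: "W x' = W x" by (simp add: x'_def bounded_clinear_op_diff[OF W])
    have gt: "(sv Z k - \<epsilon>) * norm x' < norm (W x')"
      using oproj_norm_le[OF e, of x] x False unfolding Wx x'_def[symmetric]
      by (meson diff_ge_0_iff_ge le_less_trans linorder_le_cases mult_left_mono)
    have nz: "W x' \<noteq> 0" using gt False
      by (metis diff_ge_0_iff_ge linorder_le_cases mult_nonneg_nonneg norm_ge_zero norm_zero not_less)
    then have nz': "x' \<noteq> 0" using bounded_clinear_op_zero[OF W] by auto
    define u where "u = (1 / norm x') *\<^sub>R x'"
    define v where "v = (1 / norm (W x')) *\<^sub>R W x'"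
    have Wu: "W u = (1 / norm x') *\<^sub>R W x'"
      unfolding u_def by (simp add: bounded_clinear_op_scaleR[OF W])
    have vf: "cinner v (f i) = 0" if "i < k" for i
      unfolding v_def cinner_scaleR_left by (simp add: W_def oproj_orthogonal[OF f that])
    then have fv: "cinner (f i) v = 0" if "i < k" for i
      using that by (subst cinner_commute) simp
    have "cinner (oproj f k y) v = 0" for y
      unfolding oproj_def by (simp add: cinner_sum_left cinner_scaleC_left fv)
    then have Zuv: "cinner (Z u) v = cinner (W u) v"
      by (simp add: W_def cinner_diff_left)
    also have "\<dots> = of_real (norm (W x') / norm x')"
      unfolding Wu v_def using nz
      by (simp add: cinner_scaleR_left cinner_scaleR_right cinner_self power2_eq_square)
    finally have Zuv': "cinner (Z u) v = of_real (norm (W x') / norm x')" .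
    have "sv Z k - \<epsilon> \<le> norm (W x') / norm x'"
      using gt nz' by (simp add: pos_le_divide_eq)
    moreover have "scaleC (cinner (Z u) v) v = W u"
      unfolding Zuv' scaleC_of_real Wu using nz by (simp add: v_def)
    moreover have "Z u = oproj f k (Z u) + W u" by (simp add: W_def)
    moreover have "norm u = 1" "norm v = 1" unfolding u_def v_def using nz nz' by auto
    moreover have "cinner u (e i) = 0" if "i < k" for i
      unfolding u_def x'_def cinner_scaleR_left by (simp add: oproj_orthogonal[OF e that])
    ultimately show ?thesis using vf Zuv' by (metis Re_complex_of_real)
  qed
  then obtain u v where u: "norm u = 0 \<or> norm u = 1" "\<And>i. i < k \<Longrightarrow> cinner u (e i) = 0"
    and v: "norm v = 0 \<or> norm v = 1" "\<And>i. i < k \<Longrightarrow> cinner v (f i) = 0"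
    and uv: "sv Z k - \<epsilon> \<le> Re (cinner (Z u) v)"
      "Z u = oproj f k (Z u) + scaleC (cinner (Z u) v) v" by blast
  \<comment> \<open>\<open>Z (e j)\<close> lies in the span of the old \<open>f i\<close>, to which
    \<open>v\<close> is orthogonal, so enlarging the projection by \<open>v\<close> preserves the
    invariant.\<close>
  have "cinner (Z (e j)) v = 0" if "j < k" for j
  proof -
    have "cinner (f i) v = 0" if "i < k" for i using v(2)[OF that] by (subst cinner_commute) simp
    then show ?thesis
      by (subst p[OF that]) (simp add: oproj_def cinner_sum_left cinner_scaleC_left)
  qed
  then have "\<forall>j<Suc k. Z ((e(k := u)) j) = oproj (f(k := v)) (Suc k) (Z ((e(k := u)) j))"
    unfolding oproj_extend using p uv(2) by (auto simp: less_Suc_eq)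
  moreover have "\<forall>j<Suc k. sv Z j - \<epsilon> \<le> Re (cinner (Z ((e(k := u)) j)) ((f(k := v)) j))"
    using s uv(1) by (auto simp: less_Suc_eq)
  moreover have "orthosys (e(k := u)) (Suc k)" "orthosys (f(k := v)) (Suc k)"
    using e f u v by (auto intro: orthosys_extend)
  ultimately show ?case by blast
qed

section \<open>Singular value decomposition of compact operators\<close>

text \<open>Gaussian elimination, one equation per induction step. In \<open>compact_op_svd\<close>
  it finds a nonzero vector in the span of k + 1 singular vectors that an operator of rank k
  kills.\<close>

lemma underdetermined_system:
  fixes c :: "'i \<Rightarrow> 'j \<Rightarrow> 'k::field"
  assumes "finite J" "finite I" "card J < card I"
  shows "\<exists>\<alpha>. (\<exists>i\<in>I. \<alpha> i \<noteq> 0) \<and> (\<forall>j\<in>J. (\<Sum>i\<in>I. \<alpha> i * c i j) = 0)"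
  using assms
proof (induction J arbitrary: I c rule: finite_induct)
  case empty
  then obtain i where "i \<in> I" by fastforce
  then show ?case by (intro exI[of _ "\<lambda>_. 1"]) auto
next
  case (insert j0 J)
  show ?case
  proof (cases "\<forall>i\<in>I. c i j0 = 0")
    case True
    have "card J < card I" using insert by simp
    from insert.IH[OF insert.prems(1) this, of c] True show ?thesis by auto
  next
    case False
    then obtain i0 where i0: "i0 \<in> I" "c i0 j0 \<noteq> 0" by blast
    define I' where "I' = I - {i0}"
    have I: "I = insert i0 I'" "i0 \<notin> I'" "finite I'" using i0 insert.prems by (auto simp: I'_def)
    have "card J < card I'" using insert.prems insert.hyps I by simp
    \<comment> \<open>Equation \<open>j0\<close> is used to eliminate the unknown at
      \<open>i0\<close>; \<open>\<beta>\<close> below restores it.\<close>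
    from insert.IH[OF I(3) this, of "\<lambda>i j. c i j - c i j0 / c i0 j0 * c i0 j"]
    obtain \<alpha> where a: "\<exists>i\<in>I'. \<alpha> i \<noteq> 0"
      "\<And>j. j \<in> J \<Longrightarrow> (\<Sum>i\<in>I'. \<alpha> i * (c i j - c i j0 / c i0 j0 * c i0 j)) = 0" by blast
    define \<beta> where "\<beta> = \<alpha>(i0 := - (\<Sum>i\<in>I'. \<alpha> i * c i j0) / c i0 j0)"
    have b: "(\<Sum>i\<in>I. \<beta> i * c i j) =
        - (\<Sum>i\<in>I'. \<alpha> i * c i j0) / c i0 j0 * c i0 j + (\<Sum>i\<in>I'. \<alpha> i * c i j)" for j
    proof -
      have "(\<Sum>i\<in>I'. \<beta> i * c i j) = (\<Sum>i\<in>I'. \<alpha> i * c i j)"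
        using I by (intro sum.cong) (auto simp: \<beta>_def)
      then show ?thesis using I by (simp add: \<beta>_def)
    qed
    have "(\<Sum>i\<in>I. \<beta> i * c i j) = 0" if "j \<in> J" for j
      using a(2)[OF that] unfolding b
      by (simp add: right_diff_distrib sum_subtractf sum_distrib_right sum_divide_distrib mult.assoc)
    moreover have "(\<Sum>i\<in>I. \<beta> i * c i j0) = 0" unfolding b using i0 by simp
    moreover have "\<exists>i\<in>I. \<beta> i \<noteq> 0" using a(1) I by (auto simp: \<beta>_def)
    ultimately show ?thesis by blast
  qed
qed

lemma onorm_approx_unit:
  assumes X: "bounded_clinear_op X" and "0 \<le> c" "c < onorm X"
  shows "\<exists>x. norm x = 1 \<and> c < norm (X x)"
proof -
  have "\<not> (\<forall>x. norm (X x) \<le> c * norm x)" using onorm_bound[of c X] assms by (meson not_less)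
  then obtain x where x: "c * norm x < norm (X x)" by (auto simp: not_le)
  then have nz: "x \<noteq> 0" using bounded_clinear_op_zero[OF X] by auto
  have "c < norm (X ((1 / norm x) *\<^sub>R x))"
    using x nz by (simp add: bounded_clinear_op_scaleR[OF X] pos_less_divide_eq)
  then show ?thesis using nz by (intro exI[of _ "(1 / norm x) *\<^sub>R x"]) auto
qed

lemma compact_op_convergent_subseq:
  fixes x :: "nat \<Rightarrow> 'a::complex_inner"
  assumes X: "compact_op X" and x: "\<And>n. norm (x n) \<le> 1"
  shows "\<exists>r l. strict_mono (r::nat\<Rightarrow>nat) \<and> (\<lambda>n. X (x (r n))) \<longlonglongrightarrow> l"
proof -
  have b: "bounded_clinear_op X" using X by (simp add: compact_op_def)
  \<comment> \<open>\<open>compact_op\<close> speaks of the open unit ball, so vectors of norm up to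
    1 are halved first and the limit is doubled afterwards.\<close>
  have "X ((1/2) *\<^sub>R x n) \<in> closure (X ` ball 0 1)" for n
    using x[of n] by (intro closure_subset[THEN subsetD] imageI) auto
  then obtain r l where r: "strict_mono (r::nat\<Rightarrow>nat)"
    and l: "((\<lambda>n. X ((1/2) *\<^sub>R x n)) \<circ> r) \<longlonglongrightarrow> l"
    using X unfolding compact_op_def compact_eq_seq_compact_metric
    by (metis (no_types, lifting) seq_compactE)
  have "(\<lambda>n. 2 *\<^sub>R ((\<lambda>n. X ((1/2) *\<^sub>R x n)) \<circ> r) n) \<longlonglongrightarrow> 2 *\<^sub>R l"
    by (intro tendsto_intros l)
  then show ?thesis using r by (auto simp: bounded_clinear_op_scaleR[OF b])
qed

text \<open>A maximising sequence whose image converges is itself Cauchy, by the parallelogram law.\<close>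

lemma compact_op_attains_norm:
  fixes X :: "'a::chilbert_space \<Rightarrow> 'a"
  assumes X: "compact_op X" and pos: "0 < onorm X"
  shows "\<exists>p. norm p = 1 \<and> norm (X p) = onorm X"
proof -
  define s where "s = onorm X"
  have b: "bounded_clinear_op X" using X by (simp add: compact_op_def)
  have "\<exists>x. norm x = 1 \<and> s - inverse (Suc n) < norm (X x)" for n
  proof (cases "0 \<le> s - inverse (Suc n)")
    case True
    show ?thesis by (rule onorm_approx_unit[OF b True]) (simp add: s_def)
  next
    case False
    obtain x where "norm x = 1" "0 < norm (X x)" using onorm_approx_unit[OF b _ pos] by auto
    then show ?thesis using False by (intro exI[of _ x]) linarith
  qed
  then obtain x where x1: "\<And>n. norm (x n) = 1" and x2: "\<And>n. s - inverse (Suc n) < norm (X (x n))"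
    by metis
  obtain r y where r: "strict_mono (r::nat\<Rightarrow>nat)" and y: "(\<lambda>n. X (x (r n))) \<longlonglongrightarrow> y"
    using compact_op_convergent_subseq[OF X, of x] x1 by auto
  have le: "norm (X (x n)) \<le> s" for n
    using bounded_clinear_op_norm[OF b, of "x n"] x1 by (simp add: s_def)
  have "(\<lambda>n. norm (X (x n))) \<longlonglongrightarrow> s"
  proof (rule tendsto_sandwich[OF _ _ _ tendsto_const])
    have "(\<lambda>n. s - inverse (real (Suc n))) \<longlonglongrightarrow> s - 0"
      by (intro tendsto_intros LIMSEQ_inverse_real_of_nat)
    then show "(\<lambda>n. s - inverse (real (Suc n))) \<longlonglongrightarrow> s" by simp
  qed (use x2 le in \<open>auto intro!: always_eventually less_imp_le\<close>)
  then have lim: "(\<lambda>n. norm (X (x (r n)))) \<longlonglongrightarrow> s"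
    using r LIMSEQ_subseq_LIMSEQ unfolding o_def by blast
  have "Cauchy (\<lambda>n. x (r n))"
  proof (rule metric_CauchyI)
    fix e :: real assume e: "e > 0"
    \<comment> \<open>The 13 exceeds 12 = 3 * 4: three errors \<open>\<eta>\<close> enter the bound
      on \<open>2 - w\<close>, and \<open>2 + w\<close> is at most 4.\<close>
    define \<eta> where "\<eta> = s * e\<^sup>2 / 13"
    have \<eta>: "\<eta> > 0" using e pos by (simp add: \<eta>_def s_def)
    obtain M1 where M1: "\<And>n. n \<ge> M1 \<Longrightarrow> s - \<eta> < norm (X (x (r n)))"
      using order_tendstoD(1)[OF lim, of "s - \<eta>"] \<eta> by (auto simp: eventually_sequentially)
    obtain M2 where M2: "\<And>m n. m \<ge> M2 \<Longrightarrow> n \<ge> M2 \<Longrightarrow> dist (X (x (r m))) (X (x (r n))) < \<eta>"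
      using metric_CauchyD[OF LIMSEQ_imp_Cauchy[OF y] \<eta>] by blast
    show "\<exists>M. \<forall>m\<ge>M. \<forall>n\<ge>M. dist (x (r m)) (x (r n)) < e"
    proof (intro exI[of _ "max M1 M2"] allI impI)
      fix m n assume mn: "m \<ge> max M1 M2" "n \<ge> max M1 M2"
      define u v where "u = x (r m)" and "v = x (r n)"
      have uv: "norm u = 1" "norm v = 1" by (auto simp: u_def v_def x1)
      define w where "w = norm (u + v)"
      have "2 * norm (X u) \<le> norm (X u + X v) + norm (X u - X v)"
        using norm_triangle_ineq[of "X u + X v" "X u - X v"] by (simp add: scaleR_2[symmetric])
      moreover have "norm (X u + X v) \<le> s * w"
        using bounded_clinear_op_norm[OF b, of "u + v"]
        by (simp add: bounded_clinear_op_add[OF b] s_def w_def)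
      moreover have "norm (X u - X v) < \<eta>" using M2[of m n] mn by (simp add: dist_norm u_def v_def)
      moreover have "s - \<eta> < norm (X u)" using M1[of m] mn by (simp add: u_def)
      ultimately have "s * (2 - w) \<le> s * (3 * (e\<^sup>2 / 13))" by (simp add: algebra_simps \<eta>_def)
      then have w: "2 - w \<le> 3 * (e\<^sup>2 / 13)"
        using pos by (simp only: mult_le_cancel_left_pos s_def[symmetric])
      have w2: "w \<le> 2" "0 \<le> w" using norm_triangle_ineq[of u v] uv by (auto simp: w_def)
      have "(norm (u - v))\<^sup>2 = 4 - w\<^sup>2"
        unfolding w_def norm_diff_square norm_add_square by (simp add: uv)
      also have "\<dots> = (2 - w) * (2 + w)" by (simp add: power2_eq_square algebra_simps)
      also have "\<dots> \<le> (2 - w) * 4" using w2 by (intro mult_left_mono) auto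
      also have "\<dots> < e\<^sup>2" using w zero_less_power[OF e, of 2] by argo
      finally show "dist (x (r m)) (x (r n)) < e"
        using e by (simp add: dist_norm u_def v_def power2_less_imp_less)
    qed
  qed
  then obtain p where p: "(\<lambda>n. x (r n)) \<longlonglongrightarrow> p"
    using Cauchy_convergent_iff convergent_def by blast
  have "(\<lambda>n. norm (x (r n))) \<longlonglongrightarrow> norm p" by (intro tendsto_intros p)
  then have "norm p = 1" by (simp add: x1 LIMSEQ_const_iff)
  moreover have "(\<lambda>n. norm (X (x (r n)))) \<longlonglongrightarrow> norm (X p)"
    by (intro tendsto_intros bounded_linear.tendsto[OF bounded_clinear_op_bl[OF b]] p)
  then have "norm (X p) = s" using lim LIMSEQ_unique by blast
  ultimately show ?thesis unfolding s_def by blast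
qed

text \<open>The square of \<open>onorm X * norm x\<close> minus the square of
  \<open>norm (X x)\<close> is nonnegative and vanishes at \<open>p\<close>, so its first variation
  there is zero. This is the eigenvalue equation of the adjoint of \<open>X\<close> times
  \<open>X\<close>, in weak form.\<close>

lemma norm_attaining_cinner:
  assumes X: "bounded_clinear_op X" and p: "norm (X p) = onorm X * norm p"
  shows "cinner (X p) (X v) = of_real ((onorm X)\<^sup>2) * cinner p v"
proof -
  let ?s = "onorm X"
  have re: "Re (cinner (X p) (X v)) = ?s\<^sup>2 * Re (cinner p v)" for v
  proof -
    have "0 \<le> 2 * t * (?s\<^sup>2 * Re (cinner p v) - Re (cinner (X p) (X v)))
            + t\<^sup>2 * (?s\<^sup>2 * (norm v)\<^sup>2 - (norm (X v))\<^sup>2)" for t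
    proof -
      have "(norm (X (p + t *\<^sub>R v)))\<^sup>2 \<le> (?s * norm (p + t *\<^sub>R v))\<^sup>2"
        using bounded_clinear_op_norm[OF X] by (intro power_mono) auto
      also have "\<dots> = ?s\<^sup>2 * (norm (p + t *\<^sub>R v))\<^sup>2" by (simp add: power_mult_distrib)
      finally show ?thesis
        unfolding bounded_clinear_op_add[OF X] bounded_clinear_op_scaleR[OF X] norm_add_square
        by (simp add: p power_mult_distrib cinner_scaleR_right algebra_simps)
    qed
    from linear_coeff_zero[OF this] show ?thesis by simp
  qed
  have "Im (cinner (X p) (X v)) = ?s\<^sup>2 * Im (cinner p v)"
    using re[of "scaleC \<i> v"]
    unfolding bounded_clinear_op_scaleC[OF X] cinner_scaleC_right by simp
  with re[of v] show ?thesis by (simp add: complex_eq_iff del: of_real_power)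
qed

lemma compact_op_compose_contraction:
  assumes X: "compact_op X" and C: "bounded_clinear_op C" "\<And>x. norm (C x) \<le> norm x"
  shows "compact_op (\<lambda>x. X (C x))"
proof -
  have "(\<lambda>x. X (C x)) ` ball 0 1 \<subseteq> X ` ball 0 1" using C(2) by (force intro: le_less_trans)
  then have "closure ((\<lambda>x. X (C x)) ` ball 0 1) \<subseteq> closure (X ` ball 0 1)" by (rule closure_mono)
  then have "compact (closure ((\<lambda>x. X (C x)) ` ball 0 1))"
    using X unfolding compact_op_def by (metis closed_closure compact_Int_closed inf.absorb_iff2)
  then show ?thesis using X C(1) by (simp add: compact_op_def bounded_clinear_op_compose)
qed

text \<open>The default 0 lets the deflation run on after the operator has vanished; it supplies the
  zero vectors that \<open>orthosys\<close> admits.\<close>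

definition top_vector :: "('a::complex_inner \<Rightarrow> 'a) \<Rightarrow> 'a" where
  "top_vector X = (if onorm X = 0 then 0 else SOME p. norm p = 1 \<and> norm (X p) = onorm X)"

text \<open>The remainders of the singular value expansion. Written as precompositions with
  projections, they inherit compactness and have decreasing norms; the fact \<open>exp\<close> in
  \<open>compact_op_svd\<close> identifies them with \<open>X\<close> minus its first terms.\<close>

primrec deflation :: "('a::complex_inner \<Rightarrow> 'a) \<Rightarrow> nat \<Rightarrow> 'a \<Rightarrow> 'a" where
  "deflation X 0 = X"
| "deflation X (Suc k) = (\<lambda>x. deflation X k
     (x - scaleC (cinner x (top_vector (deflation X k))) (top_vector (deflation X k))))"

lemma top_vector:
  fixes X :: "'a::chilbert_space \<Rightarrow> 'a"
  assumes "compact_op X"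
  shows "norm (top_vector X) = (if onorm X = 0 then 0 else 1)" "norm (X (top_vector X)) = onorm X"
proof -
  have X: "bounded_clinear_op X" using assms by (simp add: compact_op_def)
  have "norm (top_vector X) = 1 \<and> norm (X (top_vector X)) = onorm X" if "onorm X \<noteq> 0"
  proof -
    have "0 < onorm X" using that onorm_pos_le[OF bounded_clinear_op_bl[OF X]] by simp
    from someI_ex[OF compact_op_attains_norm[OF assms this]] that
    show ?thesis by (simp add: top_vector_def)
  qed
  moreover have "norm (top_vector X) = 0 \<and> norm (X (top_vector X)) = onorm X" if "onorm X = 0"
    using that bounded_clinear_op_zero[OF X] by (simp add: top_vector_def)
  ultimately show "norm (top_vector X) = (if onorm X = 0 then 0 else 1)"
    "norm (X (top_vector X)) = onorm X" by metis+
qed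

lemma compact_op_deflation:
  fixes X :: "'a::chilbert_space \<Rightarrow> 'a"
  assumes "compact_op X"
  shows "compact_op (deflation X k)" "onorm (deflation X (Suc k)) \<le> onorm (deflation X k)"
proof -
  define C where "C p x = x - scaleC (cinner x p) p" for p x :: 'a
  have C: "bounded_clinear_op (C p)" "norm (C p x) \<le> norm x"
    if "norm p = 0 \<or> norm p = 1" for p x
  proof -
    have o: "orthosys (\<lambda>_. p) 1" using that by (simp add: orthosys_def)
    have eq: "C p = (\<lambda>x. x - oproj (\<lambda>_. p) 1 x)" by (auto simp: C_def oproj_def)
    show "bounded_clinear_op (C p)" unfolding eq
      by (rule bounded_clinear_op_minus[OF _ bounded_clinear_op_oproj[OF o]])
         (simp add: bounded_clinear_op_def)
    show "norm (C p x) \<le> norm x" unfolding eq by (rule oproj_norm_le[OF o])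
  qed
  have k: "compact_op (deflation X k)" for k
  proof (induction k)
    case (Suc k)
    have "norm (top_vector (deflation X k)) = 0 \<or> norm (top_vector (deflation X k)) = 1"
      using top_vector(1)[OF Suc] by simp
    from compact_op_compose_contraction[OF Suc C[OF this]] show ?case by (simp add: C_def)
  qed (simp add: assms)
  show "compact_op (deflation X k)" by (rule k)
  have b: "bounded_clinear_op (deflation X k)" using k by (simp add: compact_op_def)
  have n: "norm (top_vector (deflation X k)) = 0 \<or> norm (top_vector (deflation X k)) = 1"
    using top_vector(1)[OF k] by simp
  show "onorm (deflation X (Suc k)) \<le> onorm (deflation X k)"
  proof (rule onorm_bound)
    fix x
    show "norm (deflation X (Suc k) x) \<le> onorm (deflation X k) * norm x"
      using order_trans[OF bounded_clinear_op_norm[OF b, of "C (top_vector (deflation X k)) x"]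
          mult_left_mono[OF C(2)[OF n] onorm_pos_le[OF bounded_clinear_op_bl[OF b]]]]
      by (simp add: C_def)
  qed (rule onorm_pos_le[OF bounded_clinear_op_bl[OF b]])
qed

text \<open>The expansion is recorded through the norms of its remainders, so that later estimates
  truncate instead of summing a series. The comparison \<open>s k \<le> sv X k\<close> is the
  direction in which \<open>X\<close> enters the final bound.\<close>

lemma compact_op_svd:
  fixes X :: "'a::chilbert_space \<Rightarrow> 'a"
  assumes "compact_op X"
  shows "\<exists>(s :: nat \<Rightarrow> real) p q. (\<forall>m. orthosys p m) \<and> (\<forall>m. orthosys q m) \<and>
    (\<forall>k. 0 \<le> s k) \<and> (\<forall>k. s (Suc k) \<le> s k) \<and> (\<forall>k. s k \<le> sv X k) \<and> s \<longlonglongrightarrow> 0 \<and>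
    (\<forall>m. bounded_clinear_op (\<lambda>x. X x - (\<Sum>k<m. scaleC (of_real (s k) * cinner x (p k)) (q k)))) \<and>
    (\<forall>m. onorm (\<lambda>x. X x - (\<Sum>k<m. scaleC (of_real (s k) * cinner x (p k)) (q k))) = s m)"
proof -
  have X: "bounded_clinear_op X" using assms by (simp add: compact_op_def)
  define D where "D = deflation X"
  define p where "p k = top_vector (D k)" for k
  define s where "s k = onorm (D k)" for k
  \<comment> \<open>If \<open>s k = 0\<close>, division by zero yields 0 and \<open>q k\<close> is a
    zero vector.\<close>
  define q where "q k = (1 / s k) *\<^sub>R D k (p k)" for k
  have D0: "D 0 = X" by (simp add: D_def)
  have DSuc: "D (Suc k) x = D k (x - scaleC (cinner x (p k)) (p k))" for k x
    by (simp add: D_def p_def)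
  have cD: "compact_op (D k)" for k by (simp add: D_def compact_op_deflation[OF assms])
  have bD: "bounded_clinear_op (D k)" for k using cD by (simp add: compact_op_def)
  have s0: "0 \<le> s k" for k unfolding s_def by (rule onorm_pos_le[OF bounded_clinear_op_bl[OF bD]])
  have sSuc: "s (Suc k) \<le> s k" for k
    unfolding s_def D_def by (rule compact_op_deflation(2)[OF assms])
  have np: "norm (p k) = (if s k = 0 then 0 else 1)" "norm (D k (p k)) = s k" for k
    unfolding p_def s_def using top_vector[OF cD] by auto
  have pp: "scaleC (cinner (p k) (p k)) (p k) = p k" for k
    using np(1)[of k] by (auto simp: cinner_self scaleC_one split: if_splits)
  have sq: "D k (p k) = s k *\<^sub>R q k" for k
    using np(2)[of k] unfolding q_def by (cases "s k = 0") auto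
  have key: "cinner (D k (p k)) (D k v) = of_real ((s k)\<^sup>2) * cinner (p k) v" for k v
    unfolding s_def by (rule norm_attaining_cinner[OF bD]) (use np in \<open>auto simp: s_def split: if_splits\<close>)
  \<comment> \<open>When \<open>D k\<close> kills \<open>p j\<close>, its top vector is zero or
    orthogonal to \<open>p j\<close> by \<open>key\<close>, so the next deflation step kills
    \<open>p j\<close> too.\<close>
  have Dp: "j < k \<Longrightarrow> D k (p j) = 0" for j k
  proof (induction k)
    case (Suc k)
    show ?case
    proof (cases "j = k")
      case True
      then show ?thesis by (simp add: DSuc pp bounded_clinear_op_zero[OF bD])
    next
      case False
      then have z: "D k (p j) = 0" using Suc by simp
      have "of_real ((s k)\<^sup>2) * cinner (p k) (p j) = 0" using key[of k "p j"] z by simp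
      then have "s k = 0 \<or> cinner (p k) (p j) = 0" by simp
      then have "p k = 0 \<or> cinner (p j) (p k) = 0"
        using np(1)[of k] cinner_commute[of "p k" "p j"] by auto
      then show ?thesis using z by (auto simp: DSuc)
    qed
  qed simp
  have orth: "cinner (p k) (p j) = 0" if "j < k" for j k
  proof -
    have "of_real ((s k)\<^sup>2) * cinner (p k) (p j) = 0" using key[of k "p j"] Dp[OF that] by simp
    then show ?thesis using np(1)[of k] by (cases "s k = 0") auto
  qed
  have op: "orthosys p m" for m
    unfolding orthosys_def
  proof (intro conjI allI impI)
    fix i j :: nat assume "i \<noteq> j"
    then show "cinner (p i) (p j) = 0"
      using orth[of i j] orth[of j i] cinner_commute[of "p i" "p j"] by (cases "i < j") auto
  qed (simp add: np)
  \<comment> \<open>By \<open>key\<close>, \<open>D j\<close> maps the complement of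
    \<open>p j\<close> into the complement of \<open>D j (p j)\<close>, and later remainders take
    only such values.\<close>
  have Dq: "j < k \<Longrightarrow> cinner (D j (p j)) (D k v) = 0" for j k v
  proof (induction k arbitrary: v)
    case (Suc k)
    show ?case
    proof (cases "j = k")
      case True
      have "cinner (p k) (v - scaleC (cinner v (p k)) (p k)) = 0"
        using pp[of k] np(1)[of k] cinner_commute[of "p k" v]
        by (auto simp: cinner_diff_right cinner_scaleC_right cinner_self split: if_splits)
      then show ?thesis by (simp add: DSuc True key)
    qed (use Suc in \<open>auto simp: DSuc\<close>)
  qed simp
  have orq: "cinner (q j) (q k) = 0" if "j < k" for j k
    unfolding q_def cinner_scaleR_left cinner_scaleR_right using Dq[OF that] by simp
  have oq: "orthosys q m" for m
    unfolding orthosys_def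
  proof (intro conjI allI impI)
    fix i j :: nat assume "i \<noteq> j"
    then show "cinner (q i) (q j) = 0"
      using orq[of i j] orq[of j i] cinner_commute[of "q i" "q j"] by (cases "i < j") auto
  next
    fix i show "norm (q i) = 0 \<or> norm (q i) = 1" using np(2)[of i] s0[of i] by (simp add: q_def)
  qed
  have exp: "X x - (\<Sum>k<m. scaleC (of_real (s k) * cinner x (p k)) (q k)) = D m x" for m x
  proof (induction m)
    case (Suc m)
    have "D (Suc m) x = D m x - scaleC (cinner x (p m)) (D m (p m))"
      by (simp add: DSuc bounded_clinear_op_diff[OF bD] bounded_clinear_op_scaleC[OF bD])
    also have "\<dots> = D m x - scaleC (of_real (s m) * cinner x (p m)) (q m)"
      by (simp add: sq scaleC_of_real[symmetric] scaleC_scaleC mult.commute)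
    finally show ?case by (simp add: Suc[symmetric] algebra_simps)
  qed (simp add: D0)
  have Xp: "X (p k) = s k *\<^sub>R q k" for k
  proof -
    have "(\<Sum>j<k. scaleC (of_real (s j) * cinner (p k) (p j)) (q j)) = 0"
      by (intro sum.neutral) (auto simp: orth)
    then show ?thesis using exp[of "p k" k] by (simp add: sq)
  qed
  \<comment> \<open>Half of the min-max principle: an operator of rank at most \<open>k\<close>
    kills some nonzero \<open>u\<close> in the span of \<open>p 0\<close> to \<open>p k\<close>,
    where \<open>X\<close> stretches by at least \<open>s k\<close>.\<close>
  have ssv: "s k \<le> sv X k" for k
  proof (cases "s k = 0")
    case True then show ?thesis using sv_nonneg[OF X] by simp
  next
    case False
    have mono: "s k \<le> s i" if "i \<le> k" for i using lift_Suc_antimono_le[of s, OF sSuc that] .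
    have pos: "s i > 0" if "i \<le> k" for i using mono[OF that] False s0[of k] by simp
    show ?thesis
    proof (rule sv_greatest)
      fix F :: "'a \<Rightarrow> 'a" assume F: "bounded_clinear_op F" "rank_le F k"
      then obtain v and c :: "'a \<Rightarrow> nat \<Rightarrow> complex" where c: "\<And>x. F x = (\<Sum>j<k. scaleC (c x j) (v j))"
        unfolding rank_le_def by metis
      obtain \<alpha> where a: "\<exists>i<Suc k. \<alpha> i \<noteq> 0" "\<And>j. j < k \<Longrightarrow> (\<Sum>i<Suc k. \<alpha> i * c (p i) j) = 0"
        using underdetermined_system[of "{..<k}" "{..<Suc k}" "\<lambda>i j. c (p i) j"] by auto
      define u where "u = (\<Sum>i<Suc k. scaleC (\<alpha> i) (p i))"
      have "F u = (\<Sum>i<Suc k. scaleC (\<alpha> i) (F (p i)))"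
        unfolding u_def bounded_clinear_op_sum[OF F(1)] bounded_clinear_op_scaleC[OF F(1)] ..
      also have "\<dots> = (\<Sum>i<Suc k. \<Sum>j<k. scaleC (\<alpha> i * c (p i) j) (v j))"
        by (simp only: c scaleC_sum_right scaleC_scaleC)
      also have "\<dots> = (\<Sum>j<k. scaleC (\<Sum>i<Suc k. \<alpha> i * c (p i) j) (v j))"
        unfolding scaleC_sum_left by (rule sum.swap)
      also have "\<dots> = 0" by (intro sum.neutral ballI) (metis a(2) lessThan_iff scaleC_zero_left)
      finally have Fu: "F u = 0" .
      have nu: "(norm u)\<^sup>2 = (\<Sum>i<Suc k. (cmod (\<alpha> i))\<^sup>2)"
        unfolding u_def orthosys_norm_comb[OF op]
        by (intro sum.cong refl) (use np(1) pos in \<open>force simp: less_Suc_eq_le\<close>)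
      have "X u = (\<Sum>i<Suc k. scaleC (\<alpha> i * of_real (s i)) (q i))"
        unfolding u_def bounded_clinear_op_sum[OF X] bounded_clinear_op_scaleC[OF X] Xp
        by (simp add: scaleC_of_real[symmetric] scaleC_scaleC)
      then have "(norm (X u))\<^sup>2 = (\<Sum>i<Suc k. (cmod (\<alpha> i * of_real (s i)))\<^sup>2 * (norm (q i))\<^sup>2)"
        using orthosys_norm_comb[OF oq] by metis
      also have "\<dots> = (\<Sum>i<Suc k. (s i)\<^sup>2 * (cmod (\<alpha> i))\<^sup>2)"
      proof (intro sum.cong refl)
        fix i assume "i \<in> {..<Suc k}"
        then have "s i > 0" using pos by simp
        then have "norm (q i) = 1" using np(2)[of i] by (simp add: q_def)
        then show "(cmod (\<alpha> i * of_real (s i)))\<^sup>2 * (norm (q i))\<^sup>2 = (s i)\<^sup>2 * (cmod (\<alpha> i))\<^sup>2"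
          by (simp add: norm_mult power_mult_distrib)
      qed
      also have "\<dots> \<ge> (\<Sum>i<Suc k. (s k)\<^sup>2 * (cmod (\<alpha> i))\<^sup>2)"
        using mono s0[of k] by (intro sum_mono mult_right_mono power_mono) auto
      finally have "(s k * norm u)\<^sup>2 \<le> (norm (X u - F u))\<^sup>2"
        by (simp add: Fu nu power_mult_distrib sum_distrib_left del: sum.lessThan_Suc)
      then have "s k * norm u \<le> norm (X u - F u)" by (rule power2_le_imp_le) simp
      also have "\<dots> \<le> onorm (\<lambda>x. X x - F x) * norm u"
        by (rule bounded_clinear_op_norm[OF bounded_clinear_op_minus[OF X F(1)]])
      finally have le: "s k * norm u \<le> onorm (\<lambda>x. X x - F x) * norm u" .
      obtain i where i: "i < Suc k" "\<alpha> i \<noteq> 0" using a(1) by blast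
      have "0 < (\<Sum>i<Suc k. (cmod (\<alpha> i))\<^sup>2)"
        using i by (intro sum_pos2[of _ i]) auto
      then have "norm u > 0" unfolding nu[symmetric] by simp
      with le show "s k \<le> onorm (\<lambda>x. X x - F x)" by simp
    qed
  qed
  \<comment> \<open>With a positive limit \<open>L\<close>, the vectors \<open>X (p k)\<close> would
    be orthogonal and of norm at least \<open>L\<close>, so no subsequence could be Cauchy.\<close>
  have "s \<longlonglongrightarrow> 0"
  proof -
    have "decseq s" using sSuc by (rule decseq_SucI)
    then obtain L where L: "s \<longlonglongrightarrow> L" "\<And>i. L \<le> s i"
      using decseq_convergent[of s 0] s0 by blast
    have L0: "0 \<le> L" using L(1) s0 by (intro LIMSEQ_le_const) auto
    have p1: "norm (p n) \<le> 1" for n using np(1)[of n] by simp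
    obtain r l where r: "strict_mono (r::nat\<Rightarrow>nat)" "(\<lambda>n. X (p (r n))) \<longlonglongrightarrow> l"
      using compact_op_convergent_subseq[OF assms, of p, OF p1] by blast
    have "L = 0"
    proof (rule ccontr)
      assume "L \<noteq> 0"
      then have L0: "L > 0" using L0 by simp
      obtain M where M: "\<And>m n. m \<ge> M \<Longrightarrow> n \<ge> M \<Longrightarrow> dist (X (p (r m))) (X (p (r n))) < L"
        using metric_CauchyD[OF LIMSEQ_imp_Cauchy[OF r(2)] L0] by blast
      define i j where "i = r M" and "j = r (Suc M)"
      have "i < j" using r(1) by (simp add: i_def j_def strict_monoD)
      have "(norm (X (p i) - X (p j)))\<^sup>2 = (norm (X (p i)))\<^sup>2 + (norm (X (p j)))\<^sup>2"
        unfolding norm_diff_square Xp cinner_scaleR_left cinner_scaleR_right orq[OF \<open>i < j\<close>] by simp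
      also have "\<dots> = (s i)\<^sup>2 + (s j)\<^sup>2" using np(2) s0 by (simp add: Xp sq[symmetric])
      also have "\<dots> \<ge> L\<^sup>2"
        using power_mono[OF L(2)[of i], of 2] L0 by (simp add: add_increasing2)
      finally have "L\<^sup>2 \<le> (norm (X (p i) - X (p j)))\<^sup>2" .
      then have "L \<le> norm (X (p i) - X (p j))" by (rule power2_le_imp_le) simp
      then show False using M[of M "Suc M"] by (simp add: dist_norm i_def j_def)
    qed
    then show ?thesis using L by simp
  qed
  moreover have "bounded_clinear_op (\<lambda>x. X x - (\<Sum>k<m. scaleC (of_real (s k) * cinner x (p k)) (q k)))"
    "onorm (\<lambda>x. X x - (\<Sum>k<m. scaleC (of_real (s k) * cinner x (p k)) (q k))) = s m" for m
    unfolding exp using bD by (auto simp: s_def)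
  ultimately show ?thesis using op oq s0 sSuc ssv by blast
qed

section \<open>Symmetric gauge functions and weak majorisation\<close>

lemma fin_supp_upd: "fin_supp x \<Longrightarrow> fin_supp (x(i := a))"
  unfolding fin_supp_def by (rule finite_subset[of _ "insert i {i. x i \<noteq> 0}"]) auto

lemma fin_supp_scale: "fin_supp x \<Longrightarrow> fin_supp (\<lambda>i. a * x i)"
  unfolding fin_supp_def by (rule finite_subset[of _ "{i. x i \<noteq> 0}"]) auto

text \<open>Shrinking a coordinate and moving mass between two coordinates are both averages of a
  vector with a sign-flipped or permuted copy of equal gauge.\<close>

lemma gauge_convex:
  assumes "symmetric_gauge \<Phi>" "fin_supp x" "fin_supp y" "0 \<le> t" "t \<le> 1" "\<Phi> y = \<Phi> x"
  shows "\<Phi> (\<lambda>i. t * x i + (1 - t) * y i) \<le> \<Phi> x"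
proof -
  have "\<Phi> (\<lambda>i. t * x i + (1 - t) * y i) \<le> \<Phi> (\<lambda>i. t * x i) + \<Phi> (\<lambda>i. (1 - t) * y i)"
    using assms(1) fin_supp_scale[OF assms(2), of t] fin_supp_scale[OF assms(3), of "1 - t"]
    unfolding symmetric_gauge_def by blast
  also have "\<dots> = t * \<Phi> x + (1 - t) * \<Phi> y"
    using assms unfolding symmetric_gauge_def by auto
  finally show ?thesis using assms(6) by (simp add: algebra_simps)
qed

lemma gauge_shrink_coordinate:
  assumes g: "symmetric_gauge \<Phi>" and x: "fin_supp x" and t: "0 \<le> t" "t \<le> 1"
  shows "\<Phi> (x(i := t * x i)) \<le> \<Phi> x"
proof -
  let ?y = "x(i := - x i)"
  have y: "fin_supp ?y" by (rule fin_supp_upd[OF x])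
  have "(\<lambda>j. \<bar>?y j\<bar>) = (\<lambda>j. \<bar>x j\<bar>)" by auto
  then have "\<Phi> ?y = \<Phi> x" using g x y unfolding symmetric_gauge_def by metis
  then have "\<Phi> (\<lambda>j. (1 + t) / 2 * x j + (1 - (1 + t) / 2) * ?y j) \<le> \<Phi> x"
    using t by (intro gauge_convex[OF g x y]) auto
  moreover have "(\<lambda>j. (1 + t) / 2 * x j + (1 - (1 + t) / 2) * ?y j) = x(i := t * x i)"
    by (auto simp: field_simps)
  ultimately show ?thesis by simp
qed

lemma gauge_mono:
  assumes g: "symmetric_gauge \<Phi>" and y: "fin_supp y"
    and xy: "\<And>i. 0 \<le> x i" "\<And>i. x i \<le> y i"
  shows "\<Phi> x \<le> \<Phi> y"
proof -
  have "fin_supp (\<lambda>i. if i \<in> S then x i else y i) \<and> \<Phi> (\<lambda>i. if i \<in> S then x i else y i) \<le> \<Phi> y"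
    if "finite S" for S
    using that
  proof (induction S rule: finite_induct)
    case (insert k S)
    let ?z = "\<lambda>i. if i \<in> S then x i else y i"
    \<comment> \<open>If \<open>y k = 0\<close>, then \<open>x k = 0\<close> and the quotient is 0,
      so the factor is right in this case too.\<close>
    have eq: "(\<lambda>i. if i \<in> insert k S then x i else y i) = ?z(k := x k / y k * ?z k)"
      using insert.hyps xy[of k] by auto
    have "0 \<le> x k / y k" "x k / y k \<le> 1"
      using xy[of k] order_trans[OF xy(1) xy(2), of k] by (auto simp: divide_le_eq_1)
    then show ?case
      unfolding eq using insert.IH gauge_shrink_coordinate[OF g, of ?z "x k / y k" k]
      by (meson fin_supp_upd order_trans)
  qed (use y in simp)
  moreover have "finite {i. y i \<noteq> 0}" using y by (simp add: fin_supp_def)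
  moreover have "(\<lambda>i. if i \<in> {i. y i \<noteq> 0} then x i else y i) = x"
  proof
    show "(if i \<in> {i. y i \<noteq> 0} then x i else y i) = x i" for i using xy[of i] by auto
  qed
  ultimately show ?thesis by metis
qed

lemma gauge_transfer:
  assumes g: "symmetric_gauge \<Phi>" and y: "fin_supp y"
    and d: "j \<noteq> k" "0 \<le> d" "d \<le> y j - y k"
  shows "\<Phi> (y(j := y j - d, k := y k + d)) \<le> \<Phi> y"
proof (cases "y j = y k")
  case True
  then have "y(j := y j - d, k := y k + d) = y" using d by (auto simp: fun_eq_iff)
  then show ?thesis by simp
next
  case False
  define \<pi> where "\<pi> = Transposition.transpose j k"
  \<comment> \<open>Averaging with the transposed copy lowers \<open>y j\<close> by
    \<open>(1 - t) * (y j - y k)\<close>, which must equal \<open>d\<close>.\<close>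
  define t where "t = 1 - d / (y j - y k)"
  have b: "bij \<pi>" by (simp add: \<pi>_def)
  have pos: "y j - y k > 0" using d False by simp
  have "{i. (y \<circ> \<pi>) i \<noteq> 0} \<subseteq> \<pi> ` {i. y i \<noteq> 0}"
    by (auto simp: \<pi>_def image_iff) (metis transpose_involutory)
  then have f: "fin_supp (y \<circ> \<pi>)" using y unfolding fin_supp_def by (meson finite_imageI finite_subset)
  have "\<Phi> (y \<circ> \<pi>) = \<Phi> y" using g y b unfolding symmetric_gauge_def by blast
  then have "\<Phi> (\<lambda>i. t * y i + (1 - t) * (y \<circ> \<pi>) i) \<le> \<Phi> y"
    using pos d by (intro gauge_convex[OF g y f]) (auto simp: t_def divide_le_eq_1)
  moreover have "(\<lambda>i. t * y i + (1 - t) * (y \<circ> \<pi>) i) = y(j := y j - d, k := y k + d)"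
  proof
    fix i
    define r where "r = d / (y j - y k)"
    have r: "r * (y j - y k) = d" using pos by (simp add: r_def)
    have *: "t * a + (1 - t) * b = a - r * (a - b)" for a b
      by (simp add: t_def r_def[symmetric] algebra_simps)
    show "t * y i + (1 - t) * (y \<circ> \<pi>) i = (y(j := y j - d, k := y k + d)) i"
    proof -
      consider "i = j" | "i = k" | "i \<noteq> j" "i \<noteq> k" by blast
      then show ?thesis
      proof cases
        case 1
        then show ?thesis using d(1) r unfolding * by (simp add: \<pi>_def)
      next
        case 2
        have "r * (y k - y j) = - d" using r by (simp add: algebra_simps)
        then show ?thesis using 2 d(1) unfolding * by (simp add: \<pi>_def)
      next
        case 3
        then show ?thesis unfolding * by (simp add: \<pi>_def)
      qed
    qed
  qed
  ultimately show ?thesis by simp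
qed

text \<open>Ky Fan dominance. Each transfer moves mass of \<open>y\<close> from an index where \<open>y\<close> exceeds \<open>x\<close> to a
  later one where it falls short, until \<open>y\<close> agrees with \<open>x\<close> at one of the two; it averages \<open>y\<close> with
  a permutation of itself, so it does not increase the gauge. Only \<open>x\<close> need be decreasing.\<close>

lemma gauge_weak_majorisation:
  assumes g: "symmetric_gauge \<Phi>"
    and x: "\<And>i. 0 \<le> x i" "\<And>i. i \<ge> n \<Longrightarrow> x i = 0" "\<And>i j. i \<le> j \<Longrightarrow> x j \<le> x i"
    and y: "\<And>i. 0 \<le> y i" "\<And>i. i \<ge> n \<Longrightarrow> y i = 0"
    and le: "\<And>m. m \<le> n \<Longrightarrow> (\<Sum>i<m. x i) \<le> (\<Sum>i<m. y i)"
  shows "\<Phi> x \<le> \<Phi> y"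
  using y le
proof (induction "card {i. i < n \<and> x i \<noteq> y i}" arbitrary: y rule: less_induct)
  case less
  have fy: "fin_supp y"
    unfolding fin_supp_def by (rule finite_subset[of _ "{..<n}"]) (use less.prems(2) not_less in auto)
  show ?case
  proof (cases "\<forall>i<n. x i \<le> y i")
    case True
    then have "x i \<le> y i" for i using x(2)[of i] less.prems(2)[of i] by (cases "i < n") auto
    then show ?thesis by (intro gauge_mono[OF g fy x(1)])
  next
    case False
    define k where "k = (LEAST i. i < n \<and> y i < x i)"
    have k: "k < n" "y k < x k"
      unfolding k_def using False LeastI_ex[of "\<lambda>i. i < n \<and> y i < x i"] by (auto simp: not_le)
    have before: "x i \<le> y i" if "i < k" for i
      using not_less_Least[of i "\<lambda>i. i < n \<and> y i < x i"] that k(1) by (auto simp: k_def[symmetric])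
    \<comment> \<open>Otherwise \<open>x\<close> and \<open>y\<close> agree before \<open>k\<close>,
      and the partial sums up to and including \<open>k\<close> violate \<open>le\<close>.\<close>
    have "\<exists>j<k. x j < y j"
    proof (rule ccontr)
      assume "\<not> ?thesis"
      then have "x i = y i" if "i < k" for i using before[OF that] that by (meson antisym not_less)
      then have "(\<Sum>i<k. x i) = (\<Sum>i<k. y i)" by simp
      then show False using less.prems(3)[of "Suc k"] k by simp
    qed
    then obtain j where j: "j < k" "x j < y j" by blast
    \<comment> \<open>The smaller gap closes exactly, which lowers the number of disagreements, and
      neither index is overshot.\<close>
    define d where "d = min (y j - x j) (x k - y k)"
    define y' where "y' = y(j := y j - d, k := y k + d)"
    have d: "0 < d" "d \<le> y j - x j" "d \<le> x k - y k" using j k by (auto simp: d_def)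
    \<comment> \<open>Monotonicity of \<open>x\<close> enters here:
      \<open>y k < x k \<le> x j < y j\<close> keeps \<open>d\<close> below
      \<open>y j - y k\<close>, as \<open>gauge_transfer\<close> requires.\<close>
    have xjk: "x k \<le> x j" using x(3) j by simp
    have "{i. i < n \<and> x i \<noteq> y' i} \<subset> {i. i < n \<and> x i \<noteq> y i}"
    proof
      show "{i. i < n \<and> x i \<noteq> y' i} \<subseteq> {i. i < n \<and> x i \<noteq> y i}"
        using j k by (auto simp: y'_def split: if_splits)
      have "y' j = x j \<or> y' k = x k" using j by (auto simp: y'_def d_def min_def)
      then have "j \<notin> {i. i < n \<and> x i \<noteq> y' i} \<or> k \<notin> {i. i < n \<and> x i \<noteq> y' i}" by auto
      moreover have "j \<in> {i. i < n \<and> x i \<noteq> y i}" "k \<in> {i. i < n \<and> x i \<noteq> y i}"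
        using j k by simp_all
      ultimately show "{i. i < n \<and> x i \<noteq> y' i} \<noteq> {i. i < n \<and> x i \<noteq> y i}" by metis
    qed
    then have card: "card {i. i < n \<and> x i \<noteq> y' i} < card {i. i < n \<and> x i \<noteq> y i}"
      by (intro psubset_card_mono) auto
    have sums: "(\<Sum>i<m. x i) \<le> (\<Sum>i<m. y' i)" if "m \<le> n" for m
    proof (cases "m \<le> k")
      case True
      have "x i \<le> y' i" if "i < m" for i
        using that True before[of i] d by (auto simp: y'_def)
      then show ?thesis by (intro sum_mono) auto
    next
      case False
      have "(\<Sum>i<m. y' i) = (\<Sum>i<m. y i + ((if i = k then d else 0) - (if i = j then d else 0)))"
        using j by (intro sum.cong) (auto simp: y'_def)
      also have "\<dots> = (\<Sum>i<m. y i)" using False j by (simp add: sum.distrib sum_subtractf)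
      finally show ?thesis using less.prems(3)[OF that] by simp
    qed
    have "\<Phi> x \<le> \<Phi> y'"
    proof (rule less.hyps[OF card])
      show "0 \<le> y' i" for i
        using less.prems(1)[of i] less.prems(1)[of k] d x(1)[of j] by (auto simp: y'_def)
      show "i \<ge> n \<Longrightarrow> y' i = 0" for i using less.prems(2)[of i] j k by (auto simp: y'_def)
    qed (rule sums)
    also have "\<dots> \<le> \<Phi> y"
      unfolding y'_def using j d xjk by (intro gauge_transfer[OF g fy]) auto
    finally show ?thesis .
  qed
qed

section \<open>Variances and averages of operator fields\<close>

definition cvariance :: "'t measure \<Rightarrow> ('t \<Rightarrow> complex) \<Rightarrow> real" where
  "cvariance N f = (\<integral>t. (cmod (f t - (\<integral>u. f u \<partial>N)))\<^sup>2 \<partial>N)"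

definition ess_bounded :: "'t measure \<Rightarrow> ('t \<Rightarrow> complex) \<Rightarrow> bool" where
  "ess_bounded N f \<longleftrightarrow> f \<in> borel_measurable N \<and> (\<exists>K. AE t in N. cmod (f t) \<le> K)"

lemma ess_boundedI:
  "f \<in> borel_measurable N \<Longrightarrow> (AE t in N. cmod (f t) \<le> K) \<Longrightarrow> ess_bounded N f"
  by (auto simp: ess_bounded_def)

lemma ess_bounded_mult:
  assumes "ess_bounded N f" "ess_bounded N g" shows "ess_bounded N (\<lambda>t. f t * g t)"
proof -
  obtain K L where "AE t in N. cmod (f t) \<le> K" "AE t in N. cmod (g t) \<le> L"
    using assms by (auto simp: ess_bounded_def)
  then have "AE t in N. cmod (f t * g t) \<le> K * L"
    by eventually_elim (auto simp: norm_mult intro!: mult_mono intro: order_trans[OF norm_ge_zero])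
  then show ?thesis using assms by (auto simp: ess_bounded_def)
qed

lemma ess_bounded_diff_const:
  assumes "ess_bounded N f" shows "ess_bounded N (\<lambda>t. f t - c)"
proof -
  obtain K where "AE t in N. cmod (f t) \<le> K" using assms by (auto simp: ess_bounded_def)
  then have "AE t in N. cmod (f t - c) \<le> K + cmod c"
    by eventually_elim (metis add.commute add_le_cancel_left norm_triangle_ineq4 order_trans)
  then show ?thesis using assms by (auto simp: ess_bounded_def)
qed

context prob_space
begin

lemma ess_bounded_integrable: "ess_bounded M f \<Longrightarrow> integrable M f"
  by (auto simp: ess_bounded_def intro: integrable_const_bound)

lemma ess_bounded_integrable_square:
  assumes "ess_bounded M f" shows "integrable M (\<lambda>t. (cmod (f t))\<^sup>2)"
proof -
  obtain K where K: "AE t in M. cmod (f t) \<le> K" and [measurable]: "f \<in> borel_measurable M"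
    using assms by (auto simp: ess_bounded_def)
  from K have "AE t in M. norm ((cmod (f t))\<^sup>2) \<le> K\<^sup>2"
    by eventually_elim (auto intro: power_mono)
  then show ?thesis by (rule integrable_const_bound) simp
qed

lemma integral_le_const_AE:
  fixes f :: "'a \<Rightarrow> real"
  assumes "integrable M f" "AE t in M. f t \<le> c"
  shows "(\<integral>t. f t \<partial>M) \<le> c"
  using integral_mono_AE[OF assms(1) _ assms(2)] by (simp add: prob_space)

text \<open>Dropping the last term shows that the mean is the best constant, for the radius bound;
  keeping it and averaging over the values \<open>c\<close> of \<open>f\<close> doubles the
  variance, for the diameter bound.\<close>

lemma expectation_square_shift:
  assumes f: "ess_bounded M f"
  shows "(\<integral>t. (cmod (f t - c))\<^sup>2 \<partial>M) = cvariance M f + (cmod ((\<integral>t. f t \<partial>M) - c))\<^sup>2"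
proof -
  define m where "m = (\<integral>t. f t \<partial>M)"
  define g where "g t = f t - m" for t
  have gb: "ess_bounded M g" unfolding g_def by (rule ess_bounded_diff_const[OF f])
  define h where "h t = Re (cnj (m - c) * g t)" for t
  have ig: "integrable M (\<lambda>t. cnj (m - c) * g t)"
    by (intro integrable_mult_right ess_bounded_integrable[OF gb])
  have "(\<integral>t. g t \<partial>M) = 0"
    unfolding g_def using ess_bounded_integrable[OF f] by (simp add: m_def prob_space)
  then have h: "integrable M h" "(\<integral>t. h t \<partial>M) = 0"
    unfolding h_def using integrable_Re[OF ig] integral_Re[OF ig] by simp_all
  have "(cmod (f t - c))\<^sup>2 = (cmod (g t))\<^sup>2 + 2 * h t + (cmod (m - c))\<^sup>2" for t
    unfolding h_def g_def cmod_power2 by (simp add: power2_eq_square algebra_simps)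
  then have "(\<integral>t. (cmod (f t - c))\<^sup>2 \<partial>M) =
      (\<integral>t. (cmod (g t))\<^sup>2 + 2 * h t + (cmod (m - c))\<^sup>2 \<partial>M)" by simp
  also have "\<dots> = (\<integral>t. (cmod (g t))\<^sup>2 \<partial>M) + (cmod (m - c))\<^sup>2"
    using ess_bounded_integrable_square[OF gb] h
    by (simp add: prob_space)
  finally show ?thesis by (simp add: cvariance_def g_def m_def)
qed

text \<open>Stated with a weight \<open>\<theta>\<close> rather than as a product of standard deviations, so that summing it
  needs only sums of variances.\<close>

lemma covariance_bound:
  assumes f: "ess_bounded M f" and g: "ess_bounded M g" and \<theta>: "\<theta> > 0"
  shows "cmod ((\<integral>t. f t * g t \<partial>M) - (\<integral>t. f t \<partial>M) * (\<integral>t. g t \<partial>M))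
           \<le> (\<theta> * cvariance M f + cvariance M g / \<theta>) / 2"
proof -
  define m where "m = (\<integral>t. f t \<partial>M)"
  define n where "n = (\<integral>t. g t \<partial>M)"
  define u where "u t = f t - m" for t
  define v where "v t = g t - n" for t
  have u: "ess_bounded M u" unfolding u_def by (rule ess_bounded_diff_const[OF f])
  have v: "ess_bounded M v" unfolding v_def by (rule ess_bounded_diff_const[OF g])
  have "(\<integral>t. u t * v t \<partial>M) = (\<integral>t. f t * g t - m * g t - (n * f t - m * n) \<partial>M)"
    by (simp add: u_def v_def algebra_simps)
  also have "\<dots> = (\<integral>t. f t * g t \<partial>M) - m * n"
    using ess_bounded_integrable[OF f] ess_bounded_integrable[OF g]
      ess_bounded_integrable[OF ess_bounded_mult[OF f g]]
    by (simp add: prob_space m_def n_def)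
  finally have eq: "(\<integral>t. f t * g t \<partial>M) - m * n = (\<integral>t. u t * v t \<partial>M)" ..
  have "cmod (\<integral>t. u t * v t \<partial>M) \<le> (\<integral>t. cmod (u t * v t) \<partial>M)"
    by (rule integral_norm_bound)
  also have "\<dots> \<le> (\<integral>t. (\<theta> * (cmod (u t))\<^sup>2 + (cmod (v t))\<^sup>2 / \<theta>) / 2 \<partial>M)"
  proof (rule integral_mono)
    show "integrable M (\<lambda>t. cmod (u t * v t))"
      by (intro integrable_norm ess_bounded_integrable ess_bounded_mult u v)
    show "integrable M (\<lambda>t. (\<theta> * (cmod (u t))\<^sup>2 + (cmod (v t))\<^sup>2 / \<theta>) / 2)"
      using ess_bounded_integrable_square[OF u] ess_bounded_integrable_square[OF v] by auto
    fix t
    have "0 \<le> (\<theta> * cmod (u t) - cmod (v t))\<^sup>2 / \<theta>" using \<theta> by simp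
    also have "\<dots> = \<theta> * (cmod (u t))\<^sup>2 + (cmod (v t))\<^sup>2 / \<theta> - 2 * cmod (u t * v t)"
      using \<theta> by (simp add: norm_mult power2_eq_square field_simps)
    finally show "cmod (u t * v t) \<le> (\<theta> * (cmod (u t))\<^sup>2 + (cmod (v t))\<^sup>2 / \<theta>) / 2" by simp
  qed
  also have "\<dots> = (\<theta> * cvariance M f + cvariance M g / \<theta>) / 2"
    using ess_bounded_integrable_square[OF u] ess_bounded_integrable_square[OF v]
    by (simp add: cvariance_def u_def v_def m_def n_def)
  finally show ?thesis unfolding eq m_def[symmetric] n_def[symmetric] .
qed

end

text \<open>Working form of the hypotheses: all matrix entries are measurable, not only the
  quadratic forms, and the bound is explicit so that it passes through products.\<close>

definition bounded_field :: "'t measure \<Rightarrow> ('t \<Rightarrow> 'a::complex_inner \<Rightarrow> 'a) \<Rightarrow> real \<Rightarrow> bool" where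
  "bounded_field N A C \<longleftrightarrow> (\<forall>t\<in>space N. bounded_clinear_op (A t)) \<and>
     (\<forall>x y. (\<lambda>t. cinner (A t x) y) \<in> borel_measurable N) \<and> (AE t in N. onorm (A t) \<le> C)"

lemma bounded_field_bound:
  assumes "bounded_field N A C"
  shows "AE t in N. cmod (cinner (A t x) y) \<le> C * norm x * norm y"
proof -
  have "AE t in N. t \<in> space N \<and> onorm (A t) \<le> C"
    using assms AE_space[of N] by (auto simp: bounded_field_def)
  then show ?thesis
  proof eventually_elim
    case (elim t)
    then have b: "bounded_clinear_op (A t)" using assms by (auto simp: bounded_field_def)
    have "norm (A t x) \<le> C * norm x"
      using bounded_clinear_op_norm[OF b, of x] elim by (meson mult_right_mono norm_ge_zero order_trans)
    then show ?case
      using cauchy_schwarz[of "A t x" y] by (meson mult_right_mono norm_ge_zero order_trans)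
  qed
qed

lemma bounded_field_ess_bounded:
  assumes "bounded_field N A C"
  shows "ess_bounded N (\<lambda>t. cinner (A t x) y)"
  using assms by (intro ess_boundedI[OF _ bounded_field_bound[OF assms]]) (simp add: bounded_field_def)

lemma polarization:
  assumes T: "bounded_clinear_op T"
  shows "4 * cinner (T x) y = cinner (T (x + y)) (x + y) - cinner (T (x - y)) (x - y)
    + \<i> * cinner (T (x + scaleC \<i> y)) (x + scaleC \<i> y)
    - \<i> * cinner (T (x - scaleC \<i> y)) (x - scaleC \<i> y)"
  by (simp add: bounded_clinear_op_add[OF T] bounded_clinear_op_diff[OF T] bounded_clinear_op_scaleC[OF T]
      cinner_add_left cinner_add_right cinner_diff_left cinner_diff_right cinner_scaleC_left
      cinner_scaleC_right algebra_simps)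

lemma weak_star_measurable_cinner:
  assumes m: "weak_star_measurable N A" and b: "\<And>t. t \<in> space N \<Longrightarrow> bounded_clinear_op (A t)"
  shows "(\<lambda>t. cinner (A t x) y) \<in> borel_measurable N"
proof -
  have [measurable]: "(\<lambda>t. cinner (A t z) z) \<in> borel_measurable N" for z
    using m by (auto simp: weak_star_measurable_def)
  have "(\<lambda>t. (cinner (A t (x + y)) (x + y) - cinner (A t (x - y)) (x - y)
    + \<i> * cinner (A t (x + scaleC \<i> y)) (x + scaleC \<i> y)
    - \<i> * cinner (A t (x - scaleC \<i> y)) (x - scaleC \<i> y)) / 4) \<in> borel_measurable N"
    by measurable
  then show ?thesis
    by (rule measurable_cong[THEN iffD1, rotated]) (simp add: polarization[OF b, symmetric])
qed

text \<open>Bessel's inequality and its dual both have this form.\<close>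

definition hs_family :: "nat \<Rightarrow> (nat \<Rightarrow> 'a::complex_inner) \<Rightarrow> (nat \<Rightarrow> 'a) \<Rightarrow> bool" where
  "hs_family n x y \<longleftrightarrow>
     (\<forall>T. bounded_clinear_op T \<longrightarrow> (\<Sum>i<n. (cmod (cinner (T (x i)) (y i)))\<^sup>2) \<le> (onorm T)\<^sup>2)"

lemma hs_familyD:
  "hs_family n x y \<Longrightarrow> bounded_clinear_op T \<Longrightarrow> (\<Sum>i<n. (cmod (cinner (T (x i)) (y i)))\<^sup>2) \<le> (onorm T)\<^sup>2"
  by (simp add: hs_family_def)

lemma hs_family_bessel:
  assumes e: "orthosys e n" and x: "norm x \<le> 1"
  shows "hs_family n (\<lambda>_. x) e"
  unfolding hs_family_def
proof (intro allI impI)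
  fix T :: "'a \<Rightarrow> 'a" assume T: "bounded_clinear_op T"
  have "norm (T x) \<le> onorm T"
    using bounded_clinear_op_norm[OF T, of x] x onorm_pos_le[OF bounded_clinear_op_bl[OF T]]
    by (meson mult_left_le order_trans)
  then have "(norm (T x))\<^sup>2 \<le> (onorm T)\<^sup>2" by (intro power_mono) auto
  then show "(\<Sum>i<n. (cmod (cinner (T x) (e i)))\<^sup>2) \<le> (onorm T)\<^sup>2"
    using bessel[OF e, of "T x"] by linarith
qed

lemma hs_family_dual_bessel:
  assumes e: "orthosys e n" and y: "norm y \<le> 1"
  shows "hs_family n e (\<lambda>_. y)"
  unfolding hs_family_def
proof (intro allI impI)
  fix T :: "'a \<Rightarrow> 'a" assume T: "bounded_clinear_op T"
  have "(norm y)\<^sup>2 \<le> 1" using y by (simp add: power_le_one)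
  then have "(onorm T)\<^sup>2 * (norm y)\<^sup>2 \<le> (onorm T)\<^sup>2" by (simp add: mult_left_le)
  then show "(\<Sum>i<n. (cmod (cinner (T (e i)) y))\<^sup>2) \<le> (onorm T)\<^sup>2"
    using dual_bessel[OF e T, of y] by linarith
qed

text \<open>Quantifying over \<open>hs_family\<close> lets one estimate per field serve both rows
  and columns; in the matrix argument radius and diameter survive only through
  \<open>v\<close>.\<close>

definition field_variance_le :: "'t measure \<Rightarrow> ('t \<Rightarrow> 'a::complex_inner \<Rightarrow> 'a) \<Rightarrow> real \<Rightarrow> bool" where
  "field_variance_le N A v \<longleftrightarrow>
     (\<forall>n x y. hs_family n x y \<longrightarrow> (\<Sum>i<n. cvariance N (\<lambda>t. cinner (A t (x i)) (y i))) \<le> v)"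

context prob_space
begin

text \<open>The mean minimises the mean square distance, so the entries of \<open>T\<close> may
  replace the means; the \<open>hs_family\<close> inequality then applies to \<open>A t - T\<close>
  at almost every \<open>t\<close>.\<close>

lemma field_variance_le_radius:
  assumes A: "bounded_field M A C" and T: "bounded_clinear_op T"
    and r: "AE t in M. onorm (\<lambda>x. A t x - T x) \<le> \<alpha>"
  shows "field_variance_le M A (\<alpha>\<^sup>2)"
  unfolding field_variance_le_def
proof (intro allI impI)
  fix n and x y :: "nat \<Rightarrow> 'b" assume xy: "hs_family n x y"
  define f where "f i t = cinner (A t (x i)) (y i)" for i t
  define c where "c i = cinner (T (x i)) (y i)" for i
  have f: "ess_bounded M (f i)" for i unfolding f_def by (rule bounded_field_ess_bounded[OF A])
  have i: "integrable M (\<lambda>t. (cmod (f i t - c i))\<^sup>2)" for i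
    by (rule ess_bounded_integrable_square[OF ess_bounded_diff_const[OF f]])
  have "(\<Sum>i<n. cvariance M (f i)) \<le> (\<Sum>i<n. \<integral>t. (cmod (f i t - c i))\<^sup>2 \<partial>M)"
    by (intro sum_mono) (simp add: expectation_square_shift[OF f])
  also have "\<dots> = (\<integral>t. (\<Sum>i<n. (cmod (f i t - c i))\<^sup>2) \<partial>M)" using i by simp
  also have "\<dots> \<le> \<alpha>\<^sup>2"
  proof (rule integral_le_const_AE)
    show "AE t in M. (\<Sum>i<n. (cmod (f i t - c i))\<^sup>2) \<le> \<alpha>\<^sup>2"
      using r AE_space
    proof eventually_elim
      case (elim t)
      have b: "bounded_clinear_op (\<lambda>x. A t x - T x)"
        using A elim T by (intro bounded_clinear_op_minus) (auto simp: bounded_field_def)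
      have "(\<Sum>i<n. (cmod (f i t - c i))\<^sup>2) \<le> (onorm (\<lambda>x. A t x - T x))\<^sup>2"
        using hs_familyD[OF xy b] by (simp add: f_def c_def cinner_diff_left)
      also have "\<dots> \<le> \<alpha>\<^sup>2"
        using elim onorm_pos_le[OF bounded_clinear_op_bl[OF b]] by (intro power_mono) auto
      finally show ?case .
    qed
  qed (use i in simp)
  finally show "(\<Sum>i<n. cvariance M (\<lambda>t. cinner (A t (x i)) (y i))) \<le> \<alpha>\<^sup>2" by (simp add: f_def[abs_def])
qed

text \<open>Averaging over an independent copy: \<open>2 Var f\<close> is the mean of \<open>|f s - f t|\<^sup>2\<close>.\<close>

lemma field_variance_le_diam:
  assumes A: "bounded_field M A C"
    and r: "AE s in M. AE t in M. onorm (\<lambda>x. A s x - A t x) \<le> d"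
  shows "field_variance_le M A (d\<^sup>2 / 2)"
  unfolding field_variance_le_def
proof (intro allI impI)
  fix n and x y :: "nat \<Rightarrow> 'b" assume xy: "hs_family n x y"
  define f where "f i t = cinner (A t (x i)) (y i)" for i t
  have f: "ess_bounded M (f i)" for i unfolding f_def by (rule bounded_field_ess_bounded[OF A])
  have i: "integrable M (\<lambda>t. (cmod (f i t - c))\<^sup>2)" for i c
    by (rule ess_bounded_integrable_square[OF ess_bounded_diff_const[OF f]])
  define m where "m i = (\<integral>t. f i t \<partial>M)" for i
  \<comment> \<open>For fixed \<open>s\<close>, the mean over \<open>t\<close> is evaluated by the
    shift identity with \<open>c = f i s\<close>, so the double mean is treated one variable at a
    time.\<close>
  have pt: "AE s in M. (\<Sum>i<n. cvariance M (f i) + (cmod (f i s - m i))\<^sup>2) \<le> d\<^sup>2"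
    using r AE_space
  proof eventually_elim
    case (elim s)
    have "(\<Sum>i<n. cvariance M (f i) + (cmod (f i s - m i))\<^sup>2) =
        (\<Sum>i<n. \<integral>t. (cmod (f i t - f i s))\<^sup>2 \<partial>M)"
      by (simp add: expectation_square_shift[OF f] m_def norm_minus_commute)
    also have "\<dots> = (\<integral>t. (\<Sum>i<n. (cmod (f i t - f i s))\<^sup>2) \<partial>M)" using i by simp
    also have "\<dots> \<le> d\<^sup>2"
    proof (rule integral_le_const_AE)
      show "AE t in M. (\<Sum>i<n. (cmod (f i t - f i s))\<^sup>2) \<le> d\<^sup>2"
        using elim(1) AE_space
      proof eventually_elim
        case (elim t)
        have b: "bounded_clinear_op (\<lambda>x. A s x - A t x)"
          using A elim \<open>s \<in> space M\<close> by (intro bounded_clinear_op_minus) (auto simp: bounded_field_def)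
        have "(\<Sum>i<n. (cmod (f i t - f i s))\<^sup>2) \<le> (onorm (\<lambda>x. A s x - A t x))\<^sup>2"
          using hs_familyD[OF xy b]
          by (simp add: f_def cinner_diff_left norm_minus_commute[of "cinner (A t (x _)) (y _)"])
        also have "\<dots> \<le> d\<^sup>2"
          using elim onorm_pos_le[OF bounded_clinear_op_bl[OF b]] by (intro power_mono) auto
        finally show ?case .
      qed
    qed (use i in simp)
    finally show ?case .
  qed
  \<comment> \<open>Averaging over \<open>s\<close> turns the squared deviation into a second copy
    of the variance.\<close>
  have "2 * (\<Sum>i<n. cvariance M (f i)) =
      (\<integral>s. (\<Sum>i<n. cvariance M (f i) + (cmod (f i s - m i))\<^sup>2) \<partial>M)"
    using i by (simp add: prob_space sum.distrib cvariance_def m_def)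
  also have "\<dots> \<le> d\<^sup>2" by (rule integral_le_const_AE[OF _ pt]) (use i in simp)
  finally show "(\<Sum>i<n. cvariance M (\<lambda>t. cinner (A t (x i)) (y i))) \<le> d\<^sup>2 / 2" by (simp add: f_def[abs_def])
qed

lemma ex_mean_operator:
  fixes A :: "'a \<Rightarrow> 'b::chilbert_space \<Rightarrow> 'b"
  assumes A: "bounded_field M A C"
  shows "\<exists>T. bounded_clinear_op T \<and> (\<forall>x y. cinner (T x) y = (\<integral>t. cinner (A t x) y \<partial>M))"
proof (rule bounded_sesquilinear_operator[where C=C])
  have b: "\<And>t. t \<in> space M \<Longrightarrow> bounded_clinear_op (A t)" using A by (auto simp: bounded_field_def)
  have i: "integrable M (\<lambda>t. cinner (A t x) y)" for x y
    by (rule ess_bounded_integrable[OF bounded_field_ess_bounded[OF A]])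
  fix x y z :: 'b and a :: complex
  show "(\<integral>t. cinner (A t (x + y)) z \<partial>M) = (\<integral>t. cinner (A t x) z \<partial>M) + (\<integral>t. cinner (A t y) z \<partial>M)"
  proof -
    have "(\<integral>t. cinner (A t (x + y)) z \<partial>M) = (\<integral>t. cinner (A t x) z + cinner (A t y) z \<partial>M)"
      by (intro Bochner_Integration.integral_cong) (auto simp: bounded_clinear_op_add[OF b] cinner_add_left)
    then show ?thesis using i by simp
  qed
  show "(\<integral>t. cinner (A t (scaleC a x)) z \<partial>M) = a * (\<integral>t. cinner (A t x) z \<partial>M)"
  proof -
    have "(\<integral>t. cinner (A t (scaleC a x)) z \<partial>M) = (\<integral>t. a * cinner (A t x) z \<partial>M)"
      by (intro Bochner_Integration.integral_cong)
        (auto simp: bounded_clinear_op_scaleC[OF b] cinner_scaleC_left)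
    then show ?thesis by simp
  qed
  show "(\<integral>t. cinner (A t x) (y + z) \<partial>M) = (\<integral>t. cinner (A t x) y \<partial>M) + (\<integral>t. cinner (A t x) z \<partial>M)"
    using i by (simp add: cinner_add_right)
  show "(\<integral>t. cinner (A t x) (scaleC a z) \<partial>M) = cnj a * (\<integral>t. cinner (A t x) z \<partial>M)"
    by (simp add: cinner_scaleC_right)
  have "cmod (\<integral>t. cinner (A t x) z \<partial>M) \<le> (\<integral>t. cmod (cinner (A t x) z) \<partial>M)"
    by (rule integral_norm_bound)
  also have "\<dots> \<le> C * norm x * norm z"
    by (rule integral_le_const_AE[OF integrable_norm[OF i] bounded_field_bound[OF A]])
  finally show "cmod (\<integral>t. cinner (A t x) z \<partial>M) \<le> C * norm x * norm z" .
qed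

end

section \<open>Averages over a set as means under a probability measure\<close>

lemma bounded_field_uniform_measure:
  assumes "bounded_field \<mu> A C" "\<delta> \<in> sets \<mu>"
  shows "bounded_field (uniform_measure \<mu> \<delta>) A C"
proof -
  have "AE t in uniform_measure \<mu> \<delta>. onorm (A t) \<le> C"
    using assms by (intro AE_uniform_measureI) (auto simp: bounded_field_def)
  then show ?thesis using assms(1)
    by (auto simp: bounded_field_def space_uniform_measure
        measurable_cong_sets[OF sets_uniform_measure refl])
qed

lemma set_integral_uniform_measure:
  fixes f :: "'t \<Rightarrow> complex"
  assumes \<delta>: "\<delta> \<in> sets \<mu>" "0 < emeasure \<mu> \<delta>" "emeasure \<mu> \<delta> < \<infinity>"
    and [measurable]: "f \<in> borel_measurable \<mu>"
  shows "(LINT t:\<delta>|\<mu>. f t) = measure \<mu> \<delta> *\<^sub>R (\<integral>t. f t \<partial>uniform_measure \<mu> \<delta>)"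
proof -
  define w where "w = measure \<mu> \<delta>"
  have em: "emeasure \<mu> \<delta> = ennreal w" using \<delta>(3) by (simp add: emeasure_eq_ennreal_measure w_def)
  then have w: "w > 0" using \<delta>(2) by simp
  have "indicator \<delta> t / emeasure \<mu> \<delta> = ennreal (indicator \<delta> t / w)" for t
    unfolding em using w by (auto simp: indicator_def divide_ennreal[symmetric])
  then have "uniform_measure \<mu> \<delta> = density \<mu> (\<lambda>t. ennreal (indicator \<delta> t / w))"
    by (simp add: uniform_measure_def)
  then have "(\<integral>t. f t \<partial>uniform_measure \<mu> \<delta>) = (\<integral>t. (indicator \<delta> t / w) *\<^sub>R f t \<partial>\<mu>)"
    using w \<delta>(1) by (simp add: integral_density)
  also have "\<dots> = (\<integral>t. (1 / w) *\<^sub>R (indicator \<delta> t *\<^sub>R f t) \<partial>\<mu>)" by simp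
  also have "\<dots> = (1 / w) *\<^sub>R (LINT t:\<delta>|\<mu>. f t)"
    unfolding set_lebesgue_integral_def by (rule integral_scaleR_right)
  finally show ?thesis using w by (simp add: w_def)
qed

lemma avg_int_mean:
  fixes A :: "'t \<Rightarrow> 'a::chilbert_space \<Rightarrow> 'a"
  assumes \<delta>: "\<delta> \<in> sets \<mu>" "0 < emeasure \<mu> \<delta>" "emeasure \<mu> \<delta> < \<infinity>"
    and A: "bounded_field \<mu> A C"
  shows "bounded_clinear_op (avg_int \<mu> \<delta> A)"
    and "cinner (avg_int \<mu> \<delta> A x) y = (\<integral>t. cinner (A t x) y \<partial>uniform_measure \<mu> \<delta>)"
proof -
  interpret prob_space "uniform_measure \<mu> \<delta>"
    using \<delta> by (intro prob_space_uniform_measure) auto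
  obtain T where T: "bounded_clinear_op T"
    "\<And>x y. cinner (T x) y = (\<integral>t. cinner (A t x) y \<partial>uniform_measure \<mu> \<delta>)"
    using ex_mean_operator[OF bounded_field_uniform_measure[OF A \<delta>(1)]] by blast
  have w: "measure \<mu> \<delta> \<noteq> 0" using \<delta> by (auto simp: measure_def enn2real_eq_0_iff)
  have m: "(\<lambda>t. cinner (A t x) y) \<in> borel_measurable \<mu>" for x y using A by (simp add: bounded_field_def)
  have int: "(LINT t:\<delta>|\<mu>. cinner (A t x) y) = cinner (measure \<mu> \<delta> *\<^sub>R T x) y" for x y
    by (simp only: set_integral_uniform_measure[OF \<delta> m] T(2)[symmetric] cinner_scaleR_left
        scaleR_conv_of_real)
  \<comment> \<open>An operator is determined by its entries, so the definite description denotes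
    this multiple of \<open>T\<close>; the factor cancels in \<open>avg_int\<close>.\<close>
  have "gelfand_integral \<mu> \<delta> A = (\<lambda>x. measure \<mu> \<delta> *\<^sub>R T x)"
    unfolding gelfand_integral_def int
  proof (rule the_equality)
    show "bounded_clinear_op (\<lambda>x. measure \<mu> \<delta> *\<^sub>R T x) \<and>
        (\<forall>f g. cinner (measure \<mu> \<delta> *\<^sub>R T f) g = cinner (measure \<mu> \<delta> *\<^sub>R T f) g)"
      by (simp add: bounded_clinear_op_scale[OF T(1)])
    fix S assume "bounded_clinear_op S \<and> (\<forall>f g. cinner (S f) g = cinner (measure \<mu> \<delta> *\<^sub>R T f) g)"
    then show "S = (\<lambda>x. measure \<mu> \<delta> *\<^sub>R T x)" by (intro ext cinner_eq_imp_eq) blast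
  qed
  then have "avg_int \<mu> \<delta> A = T" using w by (auto simp: avg_int_def)
  with T show "bounded_clinear_op (avg_int \<mu> \<delta> A)"
    "cinner (avg_int \<mu> \<delta> A x) y = (\<integral>t. cinner (A t x) y \<partial>uniform_measure \<mu> \<delta>)" by auto
qed

section \<open>The covariance transformer\<close>

lemma onorm_compose3_bound:
  assumes A: "bounded_clinear_op A" and X: "bounded_clinear_op X" and B: "bounded_clinear_op B"
  shows "norm (A (X (B x))) \<le> onorm A * onorm X * onorm B * norm x"
proof -
  have "norm (A (X (B x))) \<le> onorm A * norm (X (B x))" by (rule bounded_clinear_op_norm[OF A])
  also have "\<dots> \<le> onorm A * (onorm X * norm (B x))"
    by (intro mult_left_mono bounded_clinear_op_norm[OF X] onorm_pos_le bounded_clinear_op_bl[OF A])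
  also have "\<dots> \<le> onorm A * (onorm X * (onorm B * norm x))"
    by (intro mult_left_mono bounded_clinear_op_norm[OF B] onorm_pos_le bounded_clinear_op_bl[OF A]
        bounded_clinear_op_bl[OF X])
  finally show ?thesis by (simp add: mult.assoc)
qed

text \<open>Being exact, this expands both the integrand at each \<open>t\<close> and the product of
  the averages along the same terms, which can then be compared one by one.\<close>

lemma cinner_compose_expand:
  assumes A: "bounded_clinear_op A"
  shows "cinner (A (X b)) f = (\<Sum>k<m. of_real (s k) * (cinner b (p k) * cinner (A (q k)) f)) +
    cinner (A (X b - (\<Sum>k<m. scaleC (of_real (s k) * cinner b (p k)) (q k)))) f"
  by (simp add: bounded_clinear_op_diff[OF A] bounded_clinear_op_sum[OF A]
      bounded_clinear_op_scaleC[OF A] cinner_diff_left cinner_sum_left cinner_scaleC_left mult.assoc)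

text \<open>Weak measurability of a product of fields is not immediate. Inserting the decomposition
  of \<open>X\<close> makes each entry a pointwise limit of finite sums of products of scalar
  entries.\<close>

lemma bounded_field_compose_compact:
  fixes A B :: "'t \<Rightarrow> 'a::chilbert_space \<Rightarrow> 'a"
  assumes A: "bounded_field N A Ca" and B: "bounded_field N B Cb" and X: "compact_op X"
  shows "bounded_field N (\<lambda>t y. A t (X (B t y))) (Ca * onorm X * Cb)"
proof -
  have bX: "bounded_clinear_op X" using X by (simp add: compact_op_def)
  have bA: "bounded_clinear_op (A t)" and bB: "bounded_clinear_op (B t)" if "t \<in> space N" for t
    using that A B by (auto simp: bounded_field_def)
  obtain s p q where "\<And>m. orthosys p m" "\<And>m. orthosys q m" "\<And>k. 0 \<le> s k" "\<And>k. s (Suc k) \<le> s k"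
    "\<And>k. s k \<le> sv X k" and svd: "s \<longlonglongrightarrow> 0"
    "\<And>m. bounded_clinear_op (\<lambda>x. X x - (\<Sum>k<m. scaleC (of_real (s k) * cinner x (p k)) (q k)))"
    "\<And>m. onorm (\<lambda>x. X x - (\<Sum>k<m. scaleC (of_real (s k) * cinner x (p k)) (q k))) = s m"
    using compact_op_svd[OF X] by blast
  define R where "R m x = X x - (\<Sum>k<m. scaleC (of_real (s k) * cinner x (p k)) (q k))" for m x
  have bR: "bounded_clinear_op (R m)" and nR: "onorm (R m) = s m" for m
    using svd by (simp_all add: R_def[abs_def])
  have "(\<lambda>t. cinner (A t (X (B t e))) f) \<in> borel_measurable N" for e f
  proof (rule borel_measurable_LIMSEQ_metric)
    have [measurable]: "(\<lambda>t. cinner (A t x) y) \<in> borel_measurable N"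
      "(\<lambda>t. cinner (B t x) y) \<in> borel_measurable N" for x y
      using A B by (auto simp: bounded_field_def)
    show "(\<lambda>t. \<Sum>k<m. of_real (s k) * (cinner (B t e) (p k) * cinner (A t (q k)) f)) \<in> borel_measurable N" for m
      by measurable
    fix t assume t: "t \<in> space N"
    show "(\<lambda>m. \<Sum>k<m. of_real (s k) * (cinner (B t e) (p k) * cinner (A t (q k)) f)) \<longlonglongrightarrow>
        cinner (A t (X (B t e))) f"
    proof (rule LIM_zero_cancel, rule Lim_null_comparison)
      let ?K = "onorm (A t) * onorm (B t) * norm e * norm f"
      show "(\<lambda>m. s m * ?K) \<longlonglongrightarrow> 0" using tendsto_mult_left_zero[OF svd(1)] by blast
      have "norm ((\<Sum>k<m. of_real (s k) * (cinner (B t e) (p k) * cinner (A t (q k)) f))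
          - cinner (A t (X (B t e))) f) \<le> s m * ?K" for m
      proof -
        have "norm ((\<Sum>k<m. of_real (s k) * (cinner (B t e) (p k) * cinner (A t (q k)) f))
            - cinner (A t (X (B t e))) f) = cmod (cinner (A t (R m (B t e))) f)"
          by (subst cinner_compose_expand[OF bA[OF t], where m=m and s=s and p=p and q=q])
             (simp add: R_def)
        also have "\<dots> \<le> norm (A t (R m (B t e))) * norm f" by (rule cauchy_schwarz)
        also have "\<dots> \<le> onorm (A t) * onorm (R m) * onorm (B t) * norm e * norm f"
          by (intro mult_right_mono onorm_compose3_bound bA bB bR t) simp
        finally show ?thesis by (simp add: nR mult_ac)
      qed
      then show "\<forall>\<^sub>F m in sequentially. norm ((\<Sum>k<m. of_real (s k) * (cinner (B t e) (p k) *
          cinner (A t (q k)) f)) - cinner (A t (X (B t e))) f) \<le> s m * ?K" by simp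
    qed
  qed
  moreover have "AE t in N. onorm (\<lambda>y. A t (X (B t y))) \<le> Ca * onorm X * Cb"
  proof -
    have "AE t in N. onorm (A t) \<le> Ca" "AE t in N. onorm (B t) \<le> Cb"
      using A B by (auto simp: bounded_field_def)
    then show ?thesis using AE_space
    proof eventually_elim
      case (elim t)
      have pos: "0 \<le> onorm (A t)" "0 \<le> onorm X" "0 \<le> onorm (B t)"
        by (intro onorm_pos_le bounded_clinear_op_bl bA bB bX elim)+
      have "onorm (\<lambda>y. A t (X (B t y))) \<le> onorm (A t) * onorm X * onorm (B t)"
        using pos by (intro onorm_bound onorm_compose3_bound bA bB bX elim) auto
      also have "\<dots> \<le> Ca * onorm X * Cb"
        using pos elim by (intro mult_mono) auto
      finally show ?case .
    qed
  qed
  ultimately show ?thesis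
    unfolding bounded_field_def
    using bounded_clinear_op_compose[OF bA bounded_clinear_op_compose[OF bX bB]] by blast
qed

text \<open>Weights between 0 and \<open>r\<close> with total at most \<open>n * r\<close> do best
  against decreasing \<open>s\<close> by filling the first \<open>n\<close> places. Measuring
  \<open>s\<close> from the level \<open>s n\<close> makes the later terms nonpositive.\<close>

lemma weighted_sum_le_head:
  fixes s w :: "nat \<Rightarrow> real"
  assumes s: "\<And>k. 0 \<le> s k" "\<And>i j. i \<le> j \<Longrightarrow> s j \<le> s i"
    and w: "\<And>k. k < m \<Longrightarrow> 0 \<le> w k" "\<And>k. k < m \<Longrightarrow> w k \<le> r"
    and sum: "(\<Sum>k<m. w k) \<le> real n * r" and nm: "n \<le> m"
  shows "(\<Sum>k<m. s k * w k) \<le> r * (\<Sum>k<n. s k)"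
proof -
  have "(\<Sum>k<m. (s k - s n) * w k) \<le> (\<Sum>k<m. if k < n then (s k - s n) * r else 0)"
    using s(2) w by (intro sum_mono) (auto intro: mult_left_mono mult_nonpos_nonneg)
  also have "\<dots> = (\<Sum>k<n. (s k - s n) * r)"
    using nm by (intro sum.mono_neutral_cong_right) auto
  finally have "(\<Sum>k<m. (s k - s n) * w k) \<le> (\<Sum>k<n. (s k - s n) * r)" .
  moreover have "s n * (\<Sum>k<m. w k) \<le> s n * (real n * r)"
    using s(1) sum by (intro mult_left_mono)
  moreover have "(\<Sum>k<m. (s k - s n) * w k) = (\<Sum>k<m. s k * w k) - s n * (\<Sum>k<m. w k)"
    by (simp add: left_diff_distrib sum_subtractf sum_distrib_left)
  moreover have "(\<Sum>k<n. (s k - s n) * r) = r * (\<Sum>k<n. s k) - s n * (real n * r)"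
    by (simp add: sum_distrib_right[symmetric] sum_subtractf) (simp add: algebra_simps)
  ultimately show ?thesis by linarith
qed

context prob_space
begin

text \<open>Expanded along one truncated decomposition, the two products differ in their
  \<open>k\<close>-th terms by \<open>s k\<close> times a covariance, and each remainder is at most
  a constant times \<open>s m\<close>.\<close>

lemma compressed_covariance_bound:
  fixes A B :: "'a \<Rightarrow> 'b::chilbert_space \<Rightarrow> 'b"
  assumes A: "bounded_field M A Ca" and B: "bounded_field M B Cb"
    and Am: "bounded_clinear_op Am" "\<And>x y. cinner (Am x) y = (\<integral>t. cinner (A t x) y \<partial>M)"
    and Bm: "bounded_clinear_op Bm" "\<And>x y. cinner (Bm x) y = (\<integral>t. cinner (B t x) y \<partial>M)"
    and X: "compact_op X"
    and R: "bounded_clinear_op (\<lambda>x. X x - (\<Sum>k<m. scaleC (of_real (s k) * cinner x (p k)) (q k)))"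
      "onorm (\<lambda>x. X x - (\<Sum>k<m. scaleC (of_real (s k) * cinner x (p k)) (q k))) = s m"
    and s: "\<And>k. 0 \<le> s k" and ef: "norm e \<le> 1" "norm f \<le> 1" and \<theta>: "\<theta> > 0"
  shows "cmod ((\<integral>t. cinner (A t (X (B t e))) f \<partial>M) - cinner (Am (X (Bm e))) f) \<le>
    (\<Sum>k<m. s k * ((\<theta> * cvariance M (\<lambda>t. cinner (B t e) (p k))
        + cvariance M (\<lambda>t. cinner (A t (q k)) f) / \<theta>) / 2))
      + (Ca * Cb + onorm Am * onorm Bm) * s m"
proof -
  define R' where "R' x = X x - (\<Sum>k<m. scaleC (of_real (s k) * cinner x (p k)) (q k))" for x
  have bR: "bounded_clinear_op R'" and nR: "onorm R' = s m"
    using R by (simp_all add: R'_def[abs_def])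
  have bA: "bounded_clinear_op (A t)" and bB: "bounded_clinear_op (B t)" if "t \<in> space M" for t
    using that A B by (auto simp: bounded_field_def)
  define a where "a k t = cinner (A t (q k)) f" for k t
  define b where "b k t = cinner (B t e) (p k)" for k t
  have ea: "ess_bounded M (a k)" for k unfolding a_def by (rule bounded_field_ess_bounded[OF A])
  have eb: "ess_bounded M (b k)" for k unfolding b_def by (rule bounded_field_ess_bounded[OF B])
  have iba: "integrable M (\<lambda>t. b k t * a k t)" for k
    by (rule ess_bounded_integrable[OF ess_bounded_mult[OF eb ea]])
  have iX: "integrable M (\<lambda>t. cinner (A t (X (B t e))) f)"
    by (rule ess_bounded_integrable[OF
        bounded_field_ess_bounded[OF bounded_field_compose_compact[OF A B X]]])
  have expand: "cinner (A t (X (B t e))) f =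
      (\<Sum>k<m. of_real (s k) * (b k t * a k t)) + cinner (A t (R' (B t e))) f" if "t \<in> space M" for t
    unfolding a_def b_def R'_def by (rule cinner_compose_expand[OF bA[OF that]])
  have "integrable M (\<lambda>t. cinner (A t (X (B t e))) f - (\<Sum>k<m. of_real (s k) * (b k t * a k t)))"
    using iX iba by simp
  then have iR: "integrable M (\<lambda>t. cinner (A t (R' (B t e))) f)"
    by (rule Bochner_Integration.integrable_cong[OF refl, THEN iffD1, rotated]) (simp add: expand)
  have "(\<integral>t. cinner (A t (X (B t e))) f \<partial>M) =
      (\<integral>t. (\<Sum>k<m. of_real (s k) * (b k t * a k t)) + cinner (A t (R' (B t e))) f \<partial>M)"
    by (intro Bochner_Integration.integral_cong refl expand)
  also have "\<dots> = (\<Sum>k<m. of_real (s k) * (\<integral>t. b k t * a k t \<partial>M)) + (\<integral>t. cinner (A t (R' (B t e))) f \<partial>M)"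
    using iR iba by simp
  finally have E1: "(\<integral>t. cinner (A t (X (B t e))) f \<partial>M) =
      (\<Sum>k<m. of_real (s k) * (\<integral>t. b k t * a k t \<partial>M)) + (\<integral>t. cinner (A t (R' (B t e))) f \<partial>M)" .
  have E2: "cinner (Am (X (Bm e))) f =
      (\<Sum>k<m. of_real (s k) * ((\<integral>t. b k t \<partial>M) * (\<integral>t. a k t \<partial>M))) + cinner (Am (R' (Bm e))) f"
    unfolding a_def b_def R'_def Am(2)[symmetric] Bm(2)[symmetric]
    by (rule cinner_compose_expand[OF Am(1)])
  have B1: "cmod (\<integral>t. cinner (A t (R' (B t e))) f \<partial>M) \<le> Ca * Cb * s m"
  proof -
    have "cmod (\<integral>t. cinner (A t (R' (B t e))) f \<partial>M) \<le> (\<integral>t. cmod (cinner (A t (R' (B t e))) f) \<partial>M)"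
      by (rule integral_norm_bound)
    also have "\<dots> \<le> Ca * Cb * s m"
    proof (rule integral_le_const_AE[OF integrable_norm[OF iR]])
      have "AE t in M. onorm (A t) \<le> Ca" "AE t in M. onorm (B t) \<le> Cb"
        using A B by (auto simp: bounded_field_def)
      then show "AE t in M. cmod (cinner (A t (R' (B t e))) f) \<le> Ca * Cb * s m"
        using AE_space
      proof eventually_elim
        case (elim t)
        have pos: "0 \<le> onorm (A t)" "0 \<le> onorm (B t)"
          by (intro onorm_pos_le bounded_clinear_op_bl bA bB elim)+
        have "cmod (cinner (A t (R' (B t e))) f) \<le> norm (A t (R' (B t e))) * norm f"
          by (rule cauchy_schwarz)
        also have "\<dots> \<le> (onorm (A t) * s m * onorm (B t) * norm e) * norm f"
          unfolding nR[symmetric]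
          by (intro mult_right_mono onorm_compose3_bound bA bB bR elim) simp
        also have "\<dots> \<le> (Ca * s m * Cb * 1) * 1"
          using pos elim s ef by (intro mult_mono) (auto intro!: mult_nonneg_nonneg)
        finally show ?case by (simp add: mult_ac)
      qed
    qed
    finally show ?thesis .
  qed
  have B2: "cmod (cinner (Am (R' (Bm e))) f) \<le> onorm Am * onorm Bm * s m"
  proof -
    have pos: "0 \<le> onorm Am" "0 \<le> onorm Bm"
      by (intro onorm_pos_le bounded_clinear_op_bl Am(1) Bm(1))+
    have "cmod (cinner (Am (R' (Bm e))) f) \<le> norm (Am (R' (Bm e))) * norm f"
      by (rule cauchy_schwarz)
    also have "\<dots> \<le> (onorm Am * s m * onorm Bm * norm e) * norm f"
      unfolding nR[symmetric]
      by (intro mult_right_mono onorm_compose3_bound Am(1) Bm(1) bR) simp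
    also have "\<dots> \<le> (onorm Am * s m * onorm Bm * 1) * 1"
      using pos s ef by (intro mult_mono) (auto intro!: mult_nonneg_nonneg)
    finally show ?thesis by (simp add: mult_ac)
  qed
  have "(\<integral>t. cinner (A t (X (B t e))) f \<partial>M) - cinner (Am (X (Bm e))) f =
      (\<Sum>k<m. of_real (s k) * ((\<integral>t. b k t * a k t \<partial>M) - (\<integral>t. b k t \<partial>M) * (\<integral>t. a k t \<partial>M)))
      + ((\<integral>t. cinner (A t (R' (B t e))) f \<partial>M) - cinner (Am (R' (Bm e))) f)"
    unfolding E1 E2 by (simp add: right_diff_distrib sum_subtractf)
  also have "cmod \<dots> \<le>
      cmod (\<Sum>k<m. of_real (s k) * ((\<integral>t. b k t * a k t \<partial>M) - (\<integral>t. b k t \<partial>M) * (\<integral>t. a k t \<partial>M)))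
      + (cmod (\<integral>t. cinner (A t (R' (B t e))) f \<partial>M) + cmod (cinner (Am (R' (Bm e))) f))"
    by (intro order_trans[OF norm_triangle_ineq] add_left_mono norm_triangle_ineq4)
  also have "cmod (\<Sum>k<m. of_real (s k) * ((\<integral>t. b k t * a k t \<partial>M) - (\<integral>t. b k t \<partial>M) * (\<integral>t. a k t \<partial>M)))
      \<le> (\<Sum>k<m. s k * ((\<theta> * cvariance M (b k) + cvariance M (a k) / \<theta>) / 2))"
  proof (rule sum_norm_le)
    fix k
    show "cmod (of_real (s k) * ((\<integral>t. b k t * a k t \<partial>M) - (\<integral>t. b k t \<partial>M) * (\<integral>t. a k t \<partial>M)))
        \<le> s k * ((\<theta> * cvariance M (b k) + cvariance M (a k) / \<theta>) / 2)"
      using mult_left_mono[OF covariance_bound[OF eb ea \<theta>] s[of k], of k k] s[of k]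
      by (simp add: norm_mult)
  qed
  finally show ?thesis using B1 B2 by (simp add: a_def[abs_def] b_def[abs_def] distrib_right)
qed

text \<open>The matrix of covariance bounds has row and column sums at most \<open>\<alpha> \<beta>\<close>, by Bessel's
  inequality and its dual, so a compression of the transform is weakly majorised by \<open>X\<close>.\<close>

lemma covariance_transformer_sv:
  fixes A B :: "'a \<Rightarrow> 'b::chilbert_space \<Rightarrow> 'b"
  assumes A: "bounded_field M A Ca" and B: "bounded_field M B Cb"
    and Am: "bounded_clinear_op Am" "\<And>x y. cinner (Am x) y = (\<integral>t. cinner (A t x) y \<partial>M)"
    and Bm: "bounded_clinear_op Bm" "\<And>x y. cinner (Bm x) y = (\<integral>t. cinner (B t x) y \<partial>M)"
    and Y: "bounded_clinear_op Y" "\<And>x y. cinner (Y x) y = (\<integral>t. cinner (A t (X (B t x))) y \<partial>M)"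
    and X: "compact_op X"
    and var: "field_variance_le M A (\<alpha>\<^sup>2)" "field_variance_le M B (\<beta>\<^sup>2)" and pos: "\<alpha> > 0" "\<beta> > 0"
  shows "(\<Sum>j<n. sv (\<lambda>x. Y x - Am (X (Bm x))) j) \<le> \<alpha> * \<beta> * (\<Sum>j<n. sv X j)"
proof -
  define Z where "Z x = Y x - Am (X (Bm x))" for x
  have bX: "bounded_clinear_op X" using X by (simp add: compact_op_def)
  have bZ: "bounded_clinear_op Z"
    unfolding Z_def
    by (rule bounded_clinear_op_minus[OF Y(1)
        bounded_clinear_op_compose[OF Am(1) bounded_clinear_op_compose[OF bX Bm(1)]]])
  obtain s p q where p: "\<And>m. orthosys p m" and q: "\<And>m. orthosys q m"
    and s: "\<And>k. 0 \<le> s k" "\<And>k. s (Suc k) \<le> s k" "\<And>k. s k \<le> sv X k" "s \<longlonglongrightarrow> 0"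
    and R: "\<And>m. bounded_clinear_op (\<lambda>x. X x - (\<Sum>k<m. scaleC (of_real (s k) * cinner x (p k)) (q k)))"
      "\<And>m. onorm (\<lambda>x. X x - (\<Sum>k<m. scaleC (of_real (s k) * cinner x (p k)) (q k))) = s m"
    using compact_op_svd[OF X] by blast
  have np: "norm (p k) \<le> 1" "norm (q k) \<le> 1" for k
    using p[of "Suc k"] q[of "Suc k"] by (auto simp: orthosys_def)
  define K where "K = Ca * Cb + onorm Am * onorm Bm"
  \<comment> \<open>This choice balances the terms: \<open>\<theta> * \<beta>\<^sup>2\<close> and
    \<open>\<alpha>\<^sup>2 / \<theta>\<close> both equal \<open>\<alpha> * \<beta>\<close>.\<close>
  define \<theta> where "\<theta> = \<alpha> / \<beta>"
  have \<theta>: "\<theta> > 0" and r: "(\<theta> * \<beta>\<^sup>2 + \<alpha>\<^sup>2 / \<theta>) / 2 = \<alpha> * \<beta>"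
    using pos by (simp_all add: \<theta>_def power2_eq_square)
  \<comment> \<open>\<open>m\<close> is both the truncation index and the source of the greedy
    tolerance, so one limit removes both errors while \<open>n\<close> stays fixed.\<close>
  have main: "(\<Sum>j<n. sv Z j) \<le> \<alpha> * \<beta> * (\<Sum>k<n. sv X k) + real n * (inverse (Suc m) + K * s m)"
    if "m \<ge> n" for m
  proof -
    obtain e f where e: "orthosys e n" and f: "orthosys f n"
      and ef: "\<And>j. j < n \<Longrightarrow> sv Z j - inverse (Suc m) \<le> Re (cinner (Z (e j)) (f j))"
      using greedy_singular_systems[OF bZ, of "inverse (Suc m)" n] by auto
    have ne: "norm (e j) \<le> 1" "norm (f j) \<le> 1" if "j < n" for j
      using e f that by (auto simp: orthosys_def)
    define V where "V j k = cvariance M (\<lambda>t. cinner (B t (e j)) (p k))" for j k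
    define U where "U j k = cvariance M (\<lambda>t. cinner (A t (q k)) (f j))" for j k
    define W where "W j k = (\<theta> * V j k + U j k / \<theta>) / 2" for j k
    have W0: "0 \<le> W j k" for j k
      using \<theta> by (auto simp: W_def V_def U_def cvariance_def intro!: add_nonneg_nonneg)
    \<comment> \<open>\<open>g\<close> and \<open>h\<close> select index pairs, so that one
      computation covers rows and columns.\<close>
    have sumW: "(\<Sum>i\<in>I. W (g i) (h i)) \<le> \<alpha> * \<beta>"
      if "(\<Sum>i\<in>I. V (g i) (h i)) \<le> \<beta>\<^sup>2" "(\<Sum>i\<in>I. U (g i) (h i)) \<le> \<alpha>\<^sup>2" for I :: "nat set" and g h
    proof -
      have "(\<Sum>i\<in>I. W (g i) (h i)) =
          (\<theta> * (\<Sum>i\<in>I. V (g i) (h i)) + (\<Sum>i\<in>I. U (g i) (h i)) / \<theta>) / 2"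
        by (simp add: W_def sum.distrib sum_distrib_left sum_divide_distrib[symmetric])
      also have "\<dots> \<le> (\<theta> * \<beta>\<^sup>2 + \<alpha>\<^sup>2 / \<theta>) / 2"
        using that \<theta> by (intro divide_right_mono add_mono mult_left_mono) auto
      finally show ?thesis unfolding r .
    qed
    have row: "(\<Sum>k<m. W j k) \<le> \<alpha> * \<beta>" if j: "j < n" for j
    proof (rule sumW)
      show "(\<Sum>k<m. V j k) \<le> \<beta>\<^sup>2"
        using var(2) hs_family_bessel[OF p ne(1)[OF j]] unfolding field_variance_le_def V_def by blast
      show "(\<Sum>k<m. U j k) \<le> \<alpha>\<^sup>2"
        using var(1) hs_family_dual_bessel[OF q ne(2)[OF j]] unfolding field_variance_le_def U_def by blast
    qed
    have col: "(\<Sum>j<n. W j k) \<le> \<alpha> * \<beta>" for k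
    proof (rule sumW)
      show "(\<Sum>j<n. V j k) \<le> \<beta>\<^sup>2"
        using var(2) hs_family_dual_bessel[OF e np(1)] unfolding field_variance_le_def V_def by blast
      show "(\<Sum>j<n. U j k) \<le> \<alpha>\<^sup>2"
        using var(1) hs_family_bessel[OF f np(2)] unfolding field_variance_le_def U_def by blast
    qed
    have entry: "sv Z j \<le> (\<Sum>k<m. s k * W j k) + (inverse (Suc m) + K * s m)" if j: "j < n" for j
    proof -
      have "cmod (cinner (Z (e j)) (f j)) \<le> (\<Sum>k<m. s k * W j k) + K * s m"
        using compressed_covariance_bound[OF A B Am Bm X R s(1) ne[OF j] \<theta>]
        by (simp add: Z_def cinner_diff_left Y(2) W_def V_def U_def K_def)
      then show ?thesis using ef[OF j] complex_Re_le_cmod[of "cinner (Z (e j)) (f j)"] by linarith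
    qed
    have "(\<Sum>j<n. sv Z j) \<le> (\<Sum>j<n. (\<Sum>k<m. s k * W j k) + (inverse (Suc m) + K * s m))"
      by (intro sum_mono) (use entry in auto)
    also have "\<dots> = (\<Sum>k<m. s k * (\<Sum>j<n. W j k)) + real n * (inverse (Suc m) + K * s m)"
      by (subst sum.distrib, subst sum.swap) (simp add: sum_distrib_left)
    also have "(\<Sum>k<m. s k * (\<Sum>j<n. W j k)) \<le> \<alpha> * \<beta> * (\<Sum>k<n. s k)"
    proof (rule weighted_sum_le_head[OF s(1) _ _ col _ that])
      show "i \<le> j \<Longrightarrow> s j \<le> s i" for i j by (rule lift_Suc_antimono_le[of s, OF s(2)])
      show "0 \<le> (\<Sum>j<n. W j k)" for k by (intro sum_nonneg W0)
      have "(\<Sum>k<m. \<Sum>j<n. W j k) = (\<Sum>j<n. \<Sum>k<m. W j k)" by (rule sum.swap)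
      also have "\<dots> \<le> (\<Sum>j<n. \<alpha> * \<beta>)" by (intro sum_mono) (use row in auto)
      finally show "(\<Sum>k<m. \<Sum>j<n. W j k) \<le> real n * (\<alpha> * \<beta>)" by simp
    qed
    also have "\<alpha> * \<beta> * (\<Sum>k<n. s k) \<le> \<alpha> * \<beta> * (\<Sum>k<n. sv X k)"
      using pos s(3) by (intro mult_left_mono sum_mono) auto
    finally show ?thesis by simp
  qed
  have "(\<lambda>m. \<alpha> * \<beta> * (\<Sum>k<n. sv X k) + real n * (inverse (real (Suc m)) + K * s m)) \<longlonglongrightarrow>
      \<alpha> * \<beta> * (\<Sum>k<n. sv X k) + real n * (0 + K * 0)"
    by (intro tendsto_intros s(4) LIMSEQ_inverse_real_of_nat)
  then have "(\<Sum>j<n. sv Z j) \<le> \<alpha> * \<beta> * (\<Sum>k<n. sv X k) + real n * (0 + K * 0)"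
    by (rule LIMSEQ_le_const) (use main in blast)
  then show ?thesis by (simp add: Z_def[abs_def])
qed

end

section \<open>Essential radii and diameters\<close>

text \<open>A strict bound exposes an essential bound below \<open>c\<close> at once, without
  attaining the infimum.\<close>

lemma ess_sup_less_AE:
  assumes "ess_sup M f < c" shows "AE t in M. f t \<le> c"
proof -
  obtain c' where "AE t in M. f t \<le> c'" "c' < c"
    using assms unfolding ess_sup_def Inf_less_iff by blast
  then show ?thesis by (auto elim!: eventually_mono)
qed

text \<open>On a null space every constant is an essential bound and the infimum is minus infinity,
  hence the first hypothesis.\<close>

lemma ess_sup_nonneg:
  assumes "\<not> (AE t in M. False)" "AE t in M. 0 \<le> f t"
  shows "0 \<le> ess_sup M f"
  unfolding ess_sup_def
proof (rule Inf_greatest)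
  fix c assume "c \<in> {c. AE t in M. f t \<le> c}"
  then have "AE t in M. 0 \<le> c" using assms(2) by (auto elim: eventually_elim2)
  then show "0 \<le> c" using assms(1) by (cases "0 \<le> c") auto
qed

section \<open>Norm comparison from weakly majorised singular values\<close>

lemma ui_norm_nonneg:
  assumes "symmetric_gauge \<Phi>" shows "0 \<le> ui_norm \<Phi> X"
proof -
  have "fin_supp (\<lambda>_. 0)" by (simp add: fin_supp_def)
  \<comment> \<open>Homogeneity with factor 0 evaluates the gauge at the truncation
    \<open>n = 0\<close>.\<close>
  then have "\<Phi> (\<lambda>i. 0 * (\<lambda>_. 0::real) i) = \<bar>0\<bar> * \<Phi> (\<lambda>_. 0)"
    using assms unfolding symmetric_gauge_def by blast
  then show ?thesis unfolding ui_norm_def by (intro SUP_upper2[of 0]) auto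
qed

lemma ui_norm_weak_majorisation:
  assumes g: "symmetric_gauge \<Phi>" and Z: "bounded_clinear_op Z" and X: "bounded_clinear_op X"
    and r: "0 \<le> r" and le: "\<And>n. (\<Sum>j<n. sv Z j) \<le> r * (\<Sum>j<n. sv X j)"
  shows "ui_norm \<Phi> Z \<le> ereal r * ui_norm \<Phi> X"
  unfolding ui_norm_def[of \<Phi> Z]
proof (rule SUP_least)
  fix n
  let ?x = "\<lambda>i. if i < n then sv X i else 0"
  have f: "fin_supp ?x" unfolding fin_supp_def by (rule finite_subset[of _ "{..<n}"]) auto
  have "\<Phi> (\<lambda>i. if i < n then sv Z i else 0) \<le> \<Phi> (\<lambda>i. r * ?x i)"
  proof (rule gauge_weak_majorisation[OF g, of _ n])
    fix m :: nat assume m: "m \<le> n"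
    have "(\<Sum>i<m. if i < n then sv Z i else 0) = (\<Sum>i<m. sv Z i)"
      "(\<Sum>i<m. r * ?x i) = r * (\<Sum>i<m. sv X i)"
      using m by (auto simp: sum_distrib_left intro!: sum.cong)
    then show "(\<Sum>i<m. if i < n then sv Z i else 0) \<le> (\<Sum>i<m. r * ?x i)" using le by simp
  qed (use r sv_nonneg[OF Z] sv_nonneg[OF X] sv_antimono[OF Z] in auto)
  also have "\<dots> = r * \<Phi> ?x" using g f r unfolding symmetric_gauge_def by simp
  finally have "ereal (\<Phi> (\<lambda>i. if i < n then sv Z i else 0)) \<le> ereal r * ereal (\<Phi> ?x)" by simp
  also have "\<dots> \<le> ereal r * ui_norm \<Phi> X"
    unfolding ui_norm_def using r by (intro ereal_mult_left_mono SUP_upper) auto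
  finally show "ereal (\<Phi> (\<lambda>i. if i < n then sv Z i else 0)) \<le> ereal r * ui_norm \<Phi> X" .
qed

text \<open>The factor \<open>c\<close> is 1 for radii and 1/2 for diameters. Finiteness of
  \<open>u\<close> matters when \<open>x * y = 0\<close>: with an infinite norm the approximating
  bounds would stay infinite while the limit product is 0.\<close>

lemma ereal_le_mult_limit:
  assumes le: "\<And>\<epsilon>. 0 < \<epsilon> \<Longrightarrow> z \<le> ereal ((x + \<epsilon>) * (y + \<epsilon>) * c) * ereal u"
  shows "z \<le> ereal (x * y * c) * ereal u"
proof (rule LIMSEQ_le_const)
  have "(\<lambda>n. (x + inverse (real (Suc n))) * (y + inverse (real (Suc n))) * c * u) \<longlonglongrightarrow>
      (x + 0) * (y + 0) * c * u"
    by (intro tendsto_intros LIMSEQ_inverse_real_of_nat)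
  then show "(\<lambda>n. ereal ((x + inverse (real (Suc n))) * (y + inverse (real (Suc n))) * c) * ereal u)
      \<longlonglongrightarrow> ereal (x * y * c) * ereal u"
    by (simp only: add_0_right times_ereal.simps tendsto_ereal)
  show "\<exists>N. \<forall>n\<ge>N. z \<le> ereal ((x + inverse (real (Suc n))) * (y + inverse (real (Suc n))) * c) * ereal u"
    by (intro exI[of _ 0] allI impI le) simp
qed

lemma field_radius_nonneg:
  assumes "\<not> (AE t in M. False)" and "\<And>t. t \<in> space M \<Longrightarrow> bounded_clinear_op (A t)"
  shows "0 \<le> field_radius M A"
  unfolding field_radius_def
proof (rule INF_greatest, rule ess_sup_nonneg[OF assms(1)], rule AE_I2)
  fix T t assume "T \<in> {B::'b \<Rightarrow> 'b. bounded_clinear_op B}" "t \<in> space M"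
  then show "0 \<le> ereal (onorm (\<lambda>x. A t x - T x))"
    using assms(2) by (auto intro!: onorm_pos_le bounded_clinear_op_bl bounded_clinear_op_minus)
qed

lemma field_radius_le:
  assumes "bounded_field M A C" shows "field_radius M A \<le> ereal C"
  unfolding field_radius_def
proof (rule INF_lower2[of "\<lambda>_. 0"])
  show "ess_sup M (\<lambda>t. ereal (onorm (\<lambda>x. A t x - 0))) \<le> ereal C"
    unfolding ess_sup_def by (rule Inf_lower) (use assms in \<open>simp add: bounded_field_def\<close>)
qed (simp add: bounded_clinear_op_zero_fun)

lemma field_diam_nonneg:
  assumes sf: "sigma_finite_measure M" and nn: "\<not> (AE t in M. False)"
    and b: "\<And>t. t \<in> space M \<Longrightarrow> bounded_clinear_op (A t)"
  shows "0 \<le> field_diam M A"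
  unfolding field_diam_def
proof (rule ess_sup_nonneg)
  interpret pair_sigma_finite M M using sf by (simp add: pair_sigma_finite_def)
  show "\<not> (AE p in M \<Otimes>\<^sub>M M. False)"
  proof
    assume "AE p in M \<Otimes>\<^sub>M M. False"
    then have "AE s in M. AE t in M. False" using AE_pair[of "\<lambda>_. False"] by simp
    then show False using nn by simp
  qed
  show "AE p in M \<Otimes>\<^sub>M M. 0 \<le> (case p of (s, t) \<Rightarrow> ereal (onorm (\<lambda>x. A s x - A t x)))"
    by (rule AE_I2) (auto simp: space_pair_measure
        intro!: onorm_pos_le bounded_clinear_op_bl bounded_clinear_op_minus b)
qed

lemma field_diam_le:
  assumes sf: "sigma_finite_measure M" and A: "bounded_field M A C"
  shows "field_diam M A \<le> ereal (C + C)"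
proof -
  interpret sigma_finite_measure M by (rule sf)
  obtain N where N: "{t \<in> space M. \<not> onorm (A t) \<le> C} \<subseteq> N" "emeasure M N = 0" "N \<in> sets M"
    using A by (auto simp: bounded_field_def elim!: AE_E)
  have "AE p in M \<Otimes>\<^sub>M M. (case p of (s, t) \<Rightarrow> ereal (onorm (\<lambda>x. A s x - A t x))) \<le> ereal (C + C)"
  proof (rule AE_I')
    \<comment> \<open>Exceptional pairs lie in two null strips; this explicit null set stands in for
      measurability of the operator norm.\<close>
    show "N \<times> space M \<union> space M \<times> N \<in> null_sets (M \<Otimes>\<^sub>M M)"
      using N by (intro null_sets.Un times_in_null_sets1 times_in_null_sets2) auto
    have "onorm (\<lambda>x. A s x - A t x) \<le> C + C"
      if st: "s \<in> space M" "t \<in> space M" "onorm (A s) \<le> C" "onorm (A t) \<le> C" for s t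
    proof (rule onorm_bound)
      have b: "bounded_clinear_op (A s)" "bounded_clinear_op (A t)"
        using A st by (auto simp: bounded_field_def)
      show "0 \<le> C + C" using onorm_pos_le[OF bounded_clinear_op_bl[OF b(1)]] st(3) by simp
      fix x
      have "norm (A s x - A t x) \<le> onorm (A s) * norm x + onorm (A t) * norm x"
        by (rule order_trans[OF norm_triangle_ineq4 add_mono[OF bounded_clinear_op_norm[OF b(1)]
            bounded_clinear_op_norm[OF b(2)]]])
      also have "\<dots> \<le> (C + C) * norm x"
        unfolding distrib_right using st by (intro add_mono mult_right_mono) auto
      finally show "norm (A s x - A t x) \<le> (C + C) * norm x" .
    qed
    then show "{p \<in> space (M \<Otimes>\<^sub>M M). \<not> (case p of (s, t) \<Rightarrow> ereal (onorm (\<lambda>x. A s x - A t x))) \<le> ereal (C + C)}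
        \<subseteq> N \<times> space M \<union> space M \<times> N"
      using N(1) by (force simp: space_pair_measure)
  qed
  then show ?thesis unfolding field_diam_def ess_sup_def by (intro Inf_lower) simp
qed

section \<open>From radius and diameter to variance bounds, and the final estimate\<close>

lemma field_variance_le_field_radius:
  assumes A: "bounded_field \<mu> A C"
    and \<delta>: "\<delta> \<in> sets \<mu>" "0 < emeasure \<mu> \<delta>" "emeasure \<mu> \<delta> < \<infinity>"
    and a: "field_radius \<mu> A < ereal a"
  shows "field_variance_le (uniform_measure \<mu> \<delta>) A (a\<^sup>2)"
proof -
  interpret prob_space "uniform_measure \<mu> \<delta>" using \<delta> by (intro prob_space_uniform_measure) auto
  obtain T where T: "bounded_clinear_op T" "ess_sup \<mu> (\<lambda>t. ereal (onorm (\<lambda>x. A t x - T x))) < ereal a"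
    using a unfolding field_radius_def INF_less_iff by blast
  from ess_sup_less_AE[OF T(2)] have "AE t in uniform_measure \<mu> \<delta>. onorm (\<lambda>x. A t x - T x) \<le> a"
    using \<delta>(1) by (intro AE_uniform_measureI) auto
  then show ?thesis
    by (rule field_variance_le_radius[OF bounded_field_uniform_measure[OF A \<delta>(1)] T(1)])
qed

lemma field_variance_le_field_diam:
  assumes sf: "sigma_finite_measure \<mu>" and A: "bounded_field \<mu> A C"
    and \<delta>: "\<delta> \<in> sets \<mu>" "0 < emeasure \<mu> \<delta>" "emeasure \<mu> \<delta> < \<infinity>"
    and d: "field_diam \<mu> A < ereal d"
  shows "field_variance_le (uniform_measure \<mu> \<delta>) A ((d / sqrt 2)\<^sup>2)"
proof -
  interpret s: pair_sigma_finite \<mu> \<mu> using sf by (simp add: pair_sigma_finite_def)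
  interpret prob_space "uniform_measure \<mu> \<delta>" using \<delta> by (intro prob_space_uniform_measure) auto
  have "AE p in \<mu> \<Otimes>\<^sub>M \<mu>. (case p of (s, t) \<Rightarrow> ereal (onorm (\<lambda>x. A s x - A t x))) \<le> ereal d"
    by (rule ess_sup_less_AE) (use d in \<open>simp add: field_diam_def\<close>)
  \<comment> \<open>The iterated form can be restricted to \<open>\<delta>\<close> one variable at a
    time.\<close>
  then have "AE s in \<mu>. AE t in \<mu>. onorm (\<lambda>x. A s x - A t x) \<le> d"
    by (drule_tac s.AE_pair) simp
  then have "AE s in \<mu>. AE t in uniform_measure \<mu> \<delta>. onorm (\<lambda>x. A s x - A t x) \<le> d"
    using \<delta>(1) by (auto elim!: eventually_mono intro!: AE_uniform_measureI)
  then have "AE s in uniform_measure \<mu> \<delta>. AE t in uniform_measure \<mu> \<delta>. onorm (\<lambda>x. A s x - A t x) \<le> d"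
    using \<delta>(1) by (intro AE_uniform_measureI) (auto elim!: eventually_mono)
  from field_variance_le_diam[OF bounded_field_uniform_measure[OF A \<delta>(1)] this]
  show ?thesis by (simp add: power_divide)
qed

lemma ui_norm_covariance_transformer:
  fixes A B :: "'t \<Rightarrow> 'h::chilbert_space \<Rightarrow> 'h"
  assumes A: "bounded_field \<mu> A Ca" and B: "bounded_field \<mu> B Cb"
    and \<delta>: "\<delta> \<in> sets \<mu>" "0 < emeasure \<mu> \<delta>" "emeasure \<mu> \<delta> < \<infinity>"
    and g: "symmetric_gauge \<Phi>" and X: "compact_op X"
    and var: "field_variance_le (uniform_measure \<mu> \<delta>) A (a\<^sup>2)"
      "field_variance_le (uniform_measure \<mu> \<delta>) B (b\<^sup>2)" and pos: "0 < a" "0 < b"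
  shows "ui_norm \<Phi> (\<lambda>x. avg_int \<mu> \<delta> (\<lambda>t y. A t (X (B t y))) x
      - avg_int \<mu> \<delta> A (X (avg_int \<mu> \<delta> B x))) \<le> ereal (a * b) * ui_norm \<Phi> X"
proof (rule ui_norm_weak_majorisation[OF g])
  interpret prob_space "uniform_measure \<mu> \<delta>" using \<delta> by (intro prob_space_uniform_measure) auto
  note AXB = avg_int_mean[OF \<delta> bounded_field_compose_compact[OF A B X]]
  note Am = avg_int_mean[OF \<delta> A] and Bm = avg_int_mean[OF \<delta> B]
  show bX: "bounded_clinear_op X" using X by (simp add: compact_op_def)
  show "bounded_clinear_op (\<lambda>x. avg_int \<mu> \<delta> (\<lambda>t y. A t (X (B t y))) x
      - avg_int \<mu> \<delta> A (X (avg_int \<mu> \<delta> B x)))"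
    by (rule bounded_clinear_op_minus[OF AXB(1)
        bounded_clinear_op_compose[OF Am(1) bounded_clinear_op_compose[OF bX Bm(1)]]])
  show "0 \<le> a * b" using pos by simp
  show "(\<Sum>j<n. sv (\<lambda>x. avg_int \<mu> \<delta> (\<lambda>t y. A t (X (B t y))) x
      - avg_int \<mu> \<delta> A (X (avg_int \<mu> \<delta> B x))) j) \<le> a * b * (\<Sum>j<n. sv X j)" for n
    by (rule covariance_transformer_sv[OF bounded_field_uniform_measure[OF A \<delta>(1)]
        bounded_field_uniform_measure[OF B \<delta>(1)] Am Bm AXB X var pos])
qed

theorem theorem2p8:
  fixes \<mu> :: "'t measure"
    and A B :: "'t \<Rightarrow> 'h::chilbert_space \<Rightarrow> 'h"
    and \<Phi> :: "(nat \<Rightarrow> real) \<Rightarrow> real"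
    and X :: "'h \<Rightarrow> 'h"
  assumes separable: "\<exists>D::'h set. countable D \<and> closure D = UNIV"
    and sf: "sigma_finite_measure \<mu>"
    and Ameas: "weak_star_measurable \<mu> A" and Abdd: "ae_bounded_field \<mu> A"
    and Bmeas: "weak_star_measurable \<mu> B" and Bbdd: "ae_bounded_field \<mu> B"
    and gauge: "symmetric_gauge \<Phi>"
    and X: "X \<in> ui_ideal \<Phi>"
  shows "(SUP \<delta>\<in>{\<delta>\<in>sets \<mu>. 0 < emeasure \<mu> \<delta> \<and> emeasure \<mu> \<delta> < \<infinity>}.
            ui_norm \<Phi> (\<lambda>x. avg_int \<mu> \<delta> (\<lambda>t y. A t (X (B t y))) x
                            - avg_int \<mu> \<delta> A (X (avg_int \<mu> \<delta> B x))))
         \<le> min (field_radius \<mu> A * field_radius \<mu> B)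
                (field_diam \<mu> A * field_diam \<mu> B / 2) * ui_norm \<Phi> X"
proof (rule SUP_least)
  fix \<delta> assume "\<delta> \<in> {\<delta>\<in>sets \<mu>. 0 < emeasure \<mu> \<delta> \<and> emeasure \<mu> \<delta> < \<infinity>}"
  then have \<delta>: "\<delta> \<in> sets \<mu>" "0 < emeasure \<mu> \<delta>" "emeasure \<mu> \<delta> < \<infinity>" by auto
  let ?Z = "ui_norm \<Phi> (\<lambda>x. avg_int \<mu> \<delta> (\<lambda>t y. A t (X (B t y))) x
      - avg_int \<mu> \<delta> A (X (avg_int \<mu> \<delta> B x)))"
  have cX: "compact_op X" and "ui_norm \<Phi> X < \<infinity>" using X by (auto simp: ui_ideal_def)
  then obtain u where u: "ui_norm \<Phi> X = ereal u"
    using ui_norm_nonneg[OF gauge, of X] by (cases "ui_norm \<Phi> X") auto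
  obtain Ca Cb where A: "bounded_field \<mu> A Ca" and B: "bounded_field \<mu> B Cb"
    using Abdd Bbdd weak_star_measurable_cinner[OF Ameas] weak_star_measurable_cinner[OF Bmeas]
    unfolding ae_bounded_field_def bounded_field_def by blast
  have bA: "bounded_clinear_op (A t)" and bB: "bounded_clinear_op (B t)" if "t \<in> space \<mu>" for t
    using that A B by (auto simp: bounded_field_def)
  \<comment> \<open>The set \<open>\<delta>\<close> has positive measure, which rules out a null
    space, where radius and diameter would be minus infinity.\<close>
  have nn: "\<not> (AE t in \<mu>. False)"
  proof
    assume "AE t in \<mu>. False"
    then have "\<delta> \<in> null_sets \<mu>"
      using \<delta>(1) by (auto simp: AE_iff_null_sets elim: eventually_mono)
    then show False using \<delta>(2) by auto
  qed
  note bound = ui_norm_covariance_transformer[OF A B \<delta> gauge cX]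
  have finite: "\<exists>r. x = ereal r \<and> 0 \<le> r" if "0 \<le> x" "x \<le> ereal c" for x c
    using that by (cases x) auto
  obtain ra rb where ra: "field_radius \<mu> A = ereal ra" "0 \<le> ra" and rb: "field_radius \<mu> B = ereal rb" "0 \<le> rb"
    using finite[OF field_radius_nonneg[of \<mu> A, OF nn bA] field_radius_le[OF A]]
      finite[OF field_radius_nonneg[of \<mu> B, OF nn bB] field_radius_le[OF B]] by blast
  obtain da db where da: "field_diam \<mu> A = ereal da" "0 \<le> da" and db: "field_diam \<mu> B = ereal db" "0 \<le> db"
    using finite[OF field_diam_nonneg[of \<mu> A, OF sf nn bA] field_diam_le[OF sf A]]
      finite[OF field_diam_nonneg[of \<mu> B, OF sf nn bB] field_diam_le[OF sf B]] by blast
  have radius: "?Z \<le> (field_radius \<mu> A * field_radius \<mu> B) * ui_norm \<Phi> X"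
  proof -
    have "?Z \<le> ereal (ra * rb * 1) * ereal u"
    proof (rule ereal_le_mult_limit)
      fix \<epsilon> :: real assume \<epsilon>: "0 < \<epsilon>"
      have "?Z \<le> ereal ((ra + \<epsilon>) * (rb + \<epsilon>)) * ui_norm \<Phi> X"
        by (rule bound; (rule field_variance_le_field_radius[OF A \<delta>] field_variance_le_field_radius[OF B \<delta>])?)
           (use \<epsilon> ra rb in auto)
      then show "?Z \<le> ereal ((ra + \<epsilon>) * (rb + \<epsilon>) * 1) * ereal u" by (simp add: u)
    qed
    then show ?thesis by (simp add: ra rb u)
  qed
  have diam: "?Z \<le> (field_diam \<mu> A * field_diam \<mu> B / 2) * ui_norm \<Phi> X"
  proof -
    have "?Z \<le> ereal (da * db * (1 / 2)) * ereal u"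
    proof (rule ereal_le_mult_limit)
      fix \<epsilon> :: real assume \<epsilon>: "0 < \<epsilon>"
      \<comment> \<open>Each field contributes one root of 2; together they give the 2 in the
        diameter bound.\<close>
      have "?Z \<le> ereal ((da + \<epsilon>) / sqrt 2 * ((db + \<epsilon>) / sqrt 2)) * ui_norm \<Phi> X"
        by (rule bound; (rule field_variance_le_field_diam[OF sf A \<delta>] field_variance_le_field_diam[OF sf B \<delta>])?)
           (use \<epsilon> da db in auto)
      then show "?Z \<le> ereal ((da + \<epsilon>) * (db + \<epsilon>) * (1 / 2)) * ereal u" by (simp add: u)
    qed
    then show ?thesis by (simp add: da db u)
  qed
  show "?Z \<le> min (field_radius \<mu> A * field_radius \<mu> B)
      (field_diam \<mu> A * field_diam \<mu> B / 2) * ui_norm \<Phi> X"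
    using radius diam by (simp add: min_def)
qed

end
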